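(* There exists a branch group that is not contained in $\mathcal{MF}$ and that does not have the congruence subgroup property.
   Context: $\mathcal{MF}$ is the class of groups all of whose maximal subgroups have finite index. For a finite non-empty set $X$, $X^\ast$ is the rooted tree of finite words over $X$ (root the empty word; $u$ is joined to $ux$ for $x\in X$), and $\mathrm{Aut}(X^\ast)$ is its group of automorphisms. A subgroup $G\le\mathrm{Aut}(X^\ast)$ is spherically transitive if it acts transitively on the set $X^n$ of words of length $n$ for every $n$. The rigid vertex stabiliser $\mathrm{rist}_G(v)$ of a vertex $v$ is the subgroup of all elements of $G$ that fix every vertex outside the subtree $vX^\ast$; $\mathrm{Rist}_G(n)$ is the product of all $\mathrm{rist}_G(v)$ with $v\in X^n$. A spherically transitive group $G$ is a branch group if $\mathrm{Rist}_G(n)$ has finite index in $G$ for every $n\in\mathbb{N}$. $\mathrm{St}_G(n)$ is the pointwise stabiliser of $X^n$ in $G$. A subgroup $G\le\mathrm{Aut}(X^\ast)$ has the congruence subgroup property if every normal subgroup of finite index in $G$ contains $\mathrm{St}_G(n)$ for some $n$. *)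

theory Defs
  imports "HOL-Algebra.Bij" "HOL-Algebra.Generated_Groups"
begin

section \<open>Groups\<close>

definition finite_index :: "'a set \<Rightarrow> ('a, 'b) monoid_scheme \<Rightarrow> bool" where
  "finite_index H G \<longleftrightarrow> finite (rcosets\<^bsub>G\<^esub> H)"

definition maximal_subgroup :: "'a set \<Rightarrow> ('a, 'b) monoid_scheme \<Rightarrow> bool" where
  "maximal_subgroup M G \<longleftrightarrow> subgroup M G \<and> M \<noteq> carrier G \<and>
     (\<forall>H. subgroup H G \<longrightarrow> M \<subseteq> H \<longrightarrow> H = M \<or> H = carrier G)"

definition in_MF :: "('a, 'b) monoid_scheme \<Rightarrow> bool" where
  "in_MF G \<longleftrightarrow> group G \<and> (\<forall>M. maximal_subgroup M G \<longrightarrow> finite_index M G)"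


section \<open>The rooted tree of finite words and its automorphism group\<close>

definition joined :: "'x set \<Rightarrow> 'x list \<Rightarrow> 'x list \<Rightarrow> bool" where
  "joined X u v \<longleftrightarrow> (\<exists>x\<in>X. v = u @ [x] \<or> u = v @ [x])"

definition level :: "'x set \<Rightarrow> nat \<Rightarrow> 'x list set" where
  "level X n = {w \<in> lists X. length w = n}"

definition subtree :: "'x set \<Rightarrow> 'x list \<Rightarrow> 'x list set" where
  "subtree X v = {v @ w | w. w \<in> lists X}"

definition tree_auts :: "'x set \<Rightarrow> ('x list \<Rightarrow> 'x list) set" where
  "tree_auts X = {f \<in> Bij (lists X). f [] = [] \<and>
     (\<forall>u\<in>lists X. \<forall>v\<in>lists X. joined X (f u) (f v) \<longleftrightarrow> joined X u v)}"

definition AutTree :: "'x set \<Rightarrow> ('x list \<Rightarrow> 'x list) monoid" where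
  "AutTree X = (BijGroup (lists X)) \<lparr>carrier := tree_auts X\<rparr>"

lemma subgroup_tree_auts: "subgroup (tree_auts X) (BijGroup (lists X))"
proof (rule group.subgroupI[OF group_BijGroup])
  show "tree_auts X \<subseteq> carrier (BijGroup (lists X))"
    by (auto simp: tree_auts_def BijGroup_def)
  have "(\<lambda>x\<in>lists X. x) \<in> tree_auts X"
    by (auto simp: tree_auts_def id_Bij)
  then show "tree_auts X \<noteq> {}" by blast
next
  fix f assume f: "f \<in> tree_auts X"
  then have fB: "f \<in> Bij (lists X)" and f0: "f [] = []"
    by (auto simp: tree_auts_def)
  let ?g = "inv_into (lists X) f"
  have bij: "bij_betw f (lists X) (lists X)" using fB by (simp add: Bij_def)
  have g: "?g u \<in> lists X" "f (?g u) = u" if "u \<in> lists X" for u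
    using that Bij_inv_into_mem[OF fB] bij_betw_inv_into_right[OF bij] by auto
  have g0: "?g [] = []"
    using bij_betw_inv_into_left[OF bij, of "[]"] f0 by simp
  have "joined X (?g u) (?g v) \<longleftrightarrow> joined X u v" if "u \<in> lists X" "v \<in> lists X" for u v
  proof -
    have "joined X (f (?g u)) (f (?g v)) \<longleftrightarrow> joined X (?g u) (?g v)"
      using f g(1)[OF that(1)] g(1)[OF that(2)] unfolding tree_auts_def by blast
    then show ?thesis using g(2) that by simp
  qed
  then show "inv\<^bsub>BijGroup (lists X)\<^esub> f \<in> tree_auts X"
    using restrict_inv_into_Bij[OF fB] g0
    by (simp add: inv_BijGroup[OF fB] tree_auts_def)
next
  fix f g assume fg: "f \<in> tree_auts X" "g \<in> tree_auts X"
  then have fB: "f \<in> Bij (lists X)" and gB: "g \<in> Bij (lists X)"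
    by (auto simp: tree_auts_def)
  have gl: "g u \<in> lists X" if "u \<in> lists X" for u
    using Bij_imp_funcset[OF gB] that by blast
  have "compose (lists X) f g \<in> tree_auts X"
    using fg gl compose_Bij[OF fB gB] by (simp add: tree_auts_def compose_eq)
  then show "f \<otimes>\<^bsub>BijGroup (lists X)\<^esub> g \<in> tree_auts X"
    using fB gB by (simp add: BijGroup_def)
qed

lemma group_AutTree: "group (AutTree X)"
  unfolding AutTree_def
  by (rule group.subgroup_imp_group[OF group_BijGroup subgroup_tree_auts])

definition subgrp :: "'x set \<Rightarrow> ('x list \<Rightarrow> 'x list) set \<Rightarrow> ('x list \<Rightarrow> 'x list) monoid" where
  "subgrp X G = (AutTree X) \<lparr>carrier := G\<rparr>"

lemma group_subgrp: "subgroup G (AutTree X) \<Longrightarrow> group (subgrp X G)"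
  unfolding subgrp_def by (rule group.subgroup_imp_group[OF group_AutTree])


section \<open>Branch groups and the congruence subgroup property\<close>

definition spherically_transitive :: "'x set \<Rightarrow> ('x list \<Rightarrow> 'x list) set \<Rightarrow> bool" where
  "spherically_transitive X G \<longleftrightarrow>
     (\<forall>n. \<forall>u\<in>level X n. \<forall>v\<in>level X n. \<exists>g\<in>G. g u = v)"

definition rist :: "'x set \<Rightarrow> ('x list \<Rightarrow> 'x list) set \<Rightarrow> 'x list \<Rightarrow> ('x list \<Rightarrow> 'x list) set" where
  "rist X G v = {g \<in> G. \<forall>u \<in> lists X - subtree X v. g u = u}"

text \<open>Rigid stabilisers of distinct vertices of one level commute elementwise, so their
  product, in any order of the factors, is the subgroup that they generate.\<close>

definition Rist :: "'x set \<Rightarrow> ('x list \<Rightarrow> 'x list) set \<Rightarrow> nat \<Rightarrow> ('x list \<Rightarrow> 'x list) set" where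
  "Rist X G n = generate (subgrp X G) (\<Union>v\<in>level X n. rist X G v)"

definition branch_group :: "'x set \<Rightarrow> ('x list \<Rightarrow> 'x list) set \<Rightarrow> bool" where
  "branch_group X G \<longleftrightarrow> finite X \<and> X \<noteq> {} \<and> subgroup G (AutTree X) \<and>
     spherically_transitive X G \<and> (\<forall>n. finite_index (Rist X G n) (subgrp X G))"

definition St :: "'x set \<Rightarrow> ('x list \<Rightarrow> 'x list) set \<Rightarrow> nat \<Rightarrow> ('x list \<Rightarrow> 'x list) set" where
  "St X G n = {g \<in> G. \<forall>u\<in>level X n. g u = u}"

definition congruence_subgroup_property :: "'x set \<Rightarrow> ('x list \<Rightarrow> 'x list) set \<Rightarrow> bool" where
  "congruence_subgroup_property X G \<longleftrightarrow>
     (\<forall>N. N \<lhd> subgrp X G \<longrightarrow> finite_index N (subgrp X G) \<longrightarrow> (\<exists>n. St X G n \<subseteq> N))"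

end

theory Submission
  imports Defs "HOL-Combinatorics.Permutations"
begin

text \<open>
  The example lives on the ternary tree over \<open>{0, 1, 2}\<close>. For a permutation \<open>x\<close> of the letters let
  \<open>directed x\<close> be the automorphism that permutes the children of each vertex \<open>0\<dots>01\<close> hanging off the
  ray \<open>000\<dots>\<close> by \<open>x\<close> and does nothing else; so its section at \<open>0\<close> is \<open>directed x\<close> again. The group
  \<open>Grp\<close> is generated by all finitary automorphisms (those that act by letter permutations only above
  some level) together with \<open>a = directed (0 1)\<close> and \<open>b = directed (1 2)\<close>.

  Up to finitary factors a directed automorphism equals its own copy grafted at \<open>0\<dots>0\<close>
  (\<open>directed_split\<close>), and finitary automorphisms carry this copy to every other vertex of that level.
  Hence \<open>Grp\<close> contains the sections of its elements and all their copies at arbitrary vertices; an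
  element that fixes level \<open>n\<close> is then the product of the copies of its sections at that level, so that
  \<open>St\<close> is contained in \<open>Rist\<close> and \<open>Grp\<close> is a branch group (\<open>branch_Grp\<close>).

  The product of the signs of the letter permutations on level \<open>m\<close> is a homomorphism to \<open>{1, -1}\<close>. On
  \<open>Grp\<close> it does not depend on \<open>m\<close> once \<open>m\<close> is large, being \<open>1\<close> for finitary automorphisms and \<open>-1\<close> for
  \<open>a\<close> and \<open>b\<close>. The kernel of the eventual value has finite index, but copies of \<open>a\<close> at arbitrarily deep
  vertices lie outside it, which contradicts the congruence subgroup property (\<open>not_CSP_Grp\<close>).

  The subgroup generated by the finitary automorphisms and \<open>a\<close> does not contain \<open>b\<close>, but together with
  \<open>b\<close> it generates \<open>Grp\<close>; so by Zorn's lemma it lies in a maximal subgroup \<open>M\<close> of \<open>Grp\<close> without \<open>b\<close>.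
  Suppose that \<open>M\<close> had finite index. Let \<open>A i\<close> and \<open>B i\<close> be the copies of \<open>a\<close> and \<open>b\<close> at \<open>0\<dots>01\<close> (with
  \<open>i\<close> zeros); all \<open>A i\<close> lie in \<open>M\<close>. By the pigeonhole principle \<open>B i * B j\<close> is in \<open>M\<close> for some \<open>i \<noteq> j\<close>.
  As \<open>B j\<close> is an involution commuting with \<open>A i\<close> and \<open>B i\<close>, also
  \<open>(A i * B i * B j)\<^sup>2 = (A i * B i)\<^sup>2\<close> is in \<open>M\<close>, and this is \<open>B i * A i\<close> because a product of two
  distinct transpositions of three letters has order \<open>3\<close>. So \<open>B i\<close>, and with it \<open>b\<close>, lies in \<open>M\<close>, a
  contradiction (\<open>not_MF_Grp\<close>).
\<close>

section \<open>Portraits of tree automorphisms\<close>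

text \<open>With these rules the classical reasoner would turn membership in \<^term>\<open>lists X\<close> into a statement
  about all letters of a word, to which the lemmas on tree automorphisms do not apply.\<close>

declare in_listsD [rule del] in_listsI [rule del]

lemma drop_in_lists [simp]: "w \<in> lists X \<Longrightarrow> drop n w \<in> lists X"
  by (auto simp: in_lists_conv_set dest: in_set_dropD)

text \<open>A portrait assigns to each vertex \<open>v\<close> the permutation by which the automorphism moves the
  children of \<open>v\<close>. It determines the automorphism, every choice is possible, and products and sections
  are easy to read off; so automorphisms are constructed and compared through portraits.\<close>

fun act :: "('x list \<Rightarrow> 'x \<Rightarrow> 'x) \<Rightarrow> 'x list \<Rightarrow> 'x list" where
  "act p [] = []"
| "act p (x # w) = p [] x # act (\<lambda>v. p (x # v)) w"

definition portrait_aut :: "'x set \<Rightarrow> ('x list \<Rightarrow> 'x \<Rightarrow> 'x) \<Rightarrow> 'x list \<Rightarrow> 'x list" where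
  "portrait_aut X p = restrict (act p) (lists X)"

text \<open>Letters outside \<open>X\<close> are fixed so that \<open>loc X g v\<close> permutes \<open>X\<close> in the sense of \<open>permutes\<close>, and products
  of portraits are plain compositions.\<close>

definition loc :: "'x set \<Rightarrow> ('x list \<Rightarrow> 'x list) \<Rightarrow> 'x list \<Rightarrow> 'x \<Rightarrow> 'x" where
  "loc X g v x = (if x \<in> X then last (g (v @ [x])) else x)"

definition portrait :: "'x set \<Rightarrow> ('x list \<Rightarrow> 'x \<Rightarrow> 'x) \<Rightarrow> bool" where
  "portrait X p \<longleftrightarrow> (\<forall>v\<in>lists X. p v permutes X)"

lemma portraitD: "portrait X p \<Longrightarrow> v \<in> lists X \<Longrightarrow> p v permutes X"
  by (simp add: portrait_def)

lemma length_act [simp]: "length (act p w) = length w"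
  by (induction w arbitrary: p) auto

lemma act_append: "act p (u @ w) = act p u @ act (\<lambda>v. p (u @ v)) w"
  by (induction u arbitrary: p) auto

lemma act_snoc: "act p (u @ [x]) = act p u @ [p u x]"
  by (simp add: act_append)

lemma act_cong: "(\<And>v. v \<in> lists X \<Longrightarrow> p v = q v) \<Longrightarrow> w \<in> lists X \<Longrightarrow> act p w = act q w"
  by (induction w rule: rev_induct) (auto simp: act_snoc)

lemma act_id: "(\<And>u s. w = u @ s \<Longrightarrow> s \<noteq> [] \<Longrightarrow> p u = id) \<Longrightarrow> act p w = w"
proof (induction w rule: rev_induct)
  case (snoc x w)
  have "act p w = w"
    by (rule snoc.IH, rule snoc.prems[of _ "_ @ [x]"]) auto
  moreover have "p w = id" by (rule snoc.prems[of _ "[x]"]) auto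
  ultimately show ?case by (simp add: act_snoc)
qed simp

lemma act_const_id [simp]: "act (\<lambda>v. id) w = w"
  by (rule act_id) auto

lemma act_in_lists: "portrait X p \<Longrightarrow> w \<in> lists X \<Longrightarrow> act p w \<in> lists X"
  by (induction w rule: rev_induct) (auto simp: act_snoc portrait_def permutes_in_image)

lemma portrait_shift: "portrait X p \<Longrightarrow> v \<in> lists X \<Longrightarrow> portrait X (\<lambda>u. p (v @ u))"
  by (auto simp: portrait_def)

lemma act_inj: "portrait X p \<Longrightarrow> u \<in> lists X \<Longrightarrow> v \<in> lists X \<Longrightarrow> act p u = act p v \<Longrightarrow> u = v"
proof (induction u arbitrary: p v)
  case Nil
  then show ?case by (metis length_act length_0_conv)
next
  case (Cons x u)
  then obtain y v' where v: "v = y # v'" by (cases v) auto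
  have "p [] permutes X" using Cons.prems(1) by (auto simp: portrait_def)
  then have "inj (p [])" by (rule permutes_inj)
  then have "x = y" using Cons.prems(4) v by (auto dest: injD)
  moreover have "u = v'"
    using Cons.IH[of "\<lambda>w. p (x # w)" v'] Cons.prems v \<open>x = y\<close> portrait_shift[of X p "[x]"]
    by auto
  ultimately show ?case using v by simp
qed

lemma act_surj: "portrait X p \<Longrightarrow> v \<in> lists X \<Longrightarrow> \<exists>u\<in>lists X. act p u = v"
proof (induction v arbitrary: p)
  case Nil
  show ?case by (rule bexI[of _ "[]"]) auto
next
  case (Cons y v)
  have perm: "p [] permutes X" using Cons.prems(1) by (auto simp: portrait_def)
  then obtain x where x: "p [] x = y" by (metis permutes_def)
  with perm Cons.prems(2) have xX: "x \<in> X" by (auto simp: permutes_in_image)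
  have "portrait X (\<lambda>w. p (x # w))" using portrait_shift[of X p "[x]"] Cons.prems(1) xX by auto
  from Cons.IH[OF this] obtain u where "u \<in> lists X" "act (\<lambda>w. p (x # w)) u = v"
    using Cons.prems(2) by auto
  then show ?case using x xX by (intro bexI[of _ "x # u"]) auto
qed

lemma portrait_aut_apply: "w \<in> lists X \<Longrightarrow> portrait_aut X p w = act p w"
  by (simp add: portrait_aut_def)

lemma portrait_aut_in:
  assumes p: "portrait X p"
  shows "portrait_aut X p \<in> tree_auts X"
proof -
  let ?f = "portrait_aut X p"
  have "bij_betw ?f (lists X) (lists X)"
  proof (rule bij_betwI')
    show "?f u = ?f v \<longleftrightarrow> u = v" if "u \<in> lists X" "v \<in> lists X" for u v
      using act_inj[OF p that] that by (auto simp: portrait_aut_apply)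
    show "?f u \<in> lists X" if "u \<in> lists X" for u
      using act_in_lists[OF p that] that by (simp add: portrait_aut_apply)
    show "\<exists>u\<in>lists X. v = ?f u" if v: "v \<in> lists X" for v
    proof -
      obtain u where "u \<in> lists X" "act p u = v" using act_surj[OF p v] by blast
      then show ?thesis by (intro bexI[of _ u]) (simp_all add: portrait_aut_apply)
    qed
  qed
  then have B: "?f \<in> Bij (lists X)" by (simp add: Bij_def portrait_aut_def)
  have step: "(\<exists>x\<in>X. ?f v = ?f u @ [x]) \<longleftrightarrow> (\<exists>x\<in>X. v = u @ [x])"
    if uv: "u \<in> lists X" "v \<in> lists X" for u v
  proof
    assume "\<exists>x\<in>X. ?f v = ?f u @ [x]"
    then obtain x where x: "act p v = act p u @ [x]"
      unfolding portrait_aut_apply[OF uv(1)] portrait_aut_apply[OF uv(2)] by blast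
    then have "length v = Suc (length u)" by (metis length_act length_append_singleton)
    then obtain v' y where v: "v = v' @ [y]" by (metis length_Suc_conv_rev)
    with x have "act p v' = act p u" by (simp add: act_snoc)
    then have "v' = u" using act_inj[OF p, of v' u] uv v by simp
    moreover have "y \<in> X" using v uv by simp
    ultimately show "\<exists>x\<in>X. v = u @ [x]" using v by blast
  next
    assume "\<exists>x\<in>X. v = u @ [x]"
    then obtain x where x: "x \<in> X" "v = u @ [x]" by blast
    have "p u permutes X" using p uv by (simp add: portrait_def)
    then have "p u x \<in> X" using x by (simp add: permutes_in_image)
    moreover have "?f v = ?f u @ [p u x]"
      using portrait_aut_apply[OF uv(1), of p] portrait_aut_apply[OF uv(2), of p]
      by (simp add: x(2) act_snoc)
    ultimately show "\<exists>x\<in>X. ?f v = ?f u @ [x]" by blast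
  qed
  have "joined X (?f u) (?f v) \<longleftrightarrow> joined X u v" if "u \<in> lists X" "v \<in> lists X" for u v
    using step[OF that] step[OF that(2,1)] by (simp add: joined_def bex_disj_distrib)
  then show ?thesis using B by (simp add: tree_auts_def portrait_aut_apply)
qed

lemma loc_portrait_aut:
  assumes "portrait X p" "v \<in> lists X"
  shows "loc X (portrait_aut X p) v = p v"
proof
  fix x
  have "p v x = x" if "x \<notin> X"
    by (rule permutes_not_in[OF portraitD[OF assms] that])
  then show "loc X (portrait_aut X p) v x = p v x"
    using assms(2) by (simp add: loc_def portrait_aut_apply act_snoc)
qed

lemma aut_Bij: "g \<in> tree_auts X \<Longrightarrow> g \<in> Bij (lists X)"
  by (simp add: tree_auts_def)

lemma aut_closed: "g \<in> tree_auts X \<Longrightarrow> w \<in> lists X \<Longrightarrow> g w \<in> lists X"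
  using aut_Bij Bij_imp_funcset by blast

lemma aut_inj: "g \<in> tree_auts X \<Longrightarrow> u \<in> lists X \<Longrightarrow> v \<in> lists X \<Longrightarrow> g u = g v \<longleftrightarrow> u = v"
  using aut_Bij[of g X] by (auto simp: Bij_def bij_betw_def inj_on_def)

lemma aut_surj:
  assumes "g \<in> tree_auts X" "v \<in> lists X"
  shows "\<exists>u\<in>lists X. g u = v"
proof -
  have "v \<in> g ` lists X" using assms aut_Bij[of g X] by (simp add: Bij_def bij_betw_def)
  then show ?thesis by blast
qed

lemma aut_nil: "g \<in> tree_auts X \<Longrightarrow> g [] = []"
  by (simp add: tree_auts_def)

text \<open>The definition of a tree automorphism only preserves adjacency. That children go to children holds
  because the image of a child of \<open>u\<close> could otherwise only be the parent of the image of \<open>u\<close>, which by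
  induction is already the image of the parent of \<open>u\<close>.\<close>

lemma aut_snoc_ex:
  assumes g: "g \<in> tree_auts X"
  shows "u \<in> lists X \<Longrightarrow> x \<in> X \<Longrightarrow> \<exists>y\<in>X. g (u @ [x]) = g u @ [y]"
proof (induction u arbitrary: x rule: rev_induct)
  case Nil
  have "joined X (g []) (g ([] @ [x])) \<longleftrightarrow> joined X [] ([] @ [x])"
    using g Nil unfolding tree_auts_def by blast
  then show ?case using Nil aut_nil[OF g] by (auto simp: joined_def)
next
  case (snoc z u)
  then obtain y where y: "y \<in> X" "g (u @ [z]) = g u @ [y]" by auto
  have "joined X (g (u @ [z])) (g ((u @ [z]) @ [x])) \<longleftrightarrow> joined X (u @ [z]) ((u @ [z]) @ [x])"
    using g snoc.prems unfolding tree_auts_def by auto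
  then have "joined X (g (u @ [z])) (g ((u @ [z]) @ [x]))" using snoc.prems by (auto simp: joined_def)
  moreover have False if "g (u @ [z]) = g ((u @ [z]) @ [x]) @ [t]" for t
  proof -
    from that y have "g ((u @ [z]) @ [x]) = g u" by simp
    then show False using aut_inj[OF g, of "(u @ [z]) @ [x]" u] snoc.prems by auto
  qed
  ultimately show ?case unfolding joined_def by blast
qed

lemma aut_snoc: "g \<in> tree_auts X \<Longrightarrow> u \<in> lists X \<Longrightarrow> x \<in> X \<Longrightarrow> g (u @ [x]) = g u @ [loc X g u x]"
  using aut_snoc_ex[of g X u x] by (auto simp: loc_def)

lemma aut_act: "g \<in> tree_auts X \<Longrightarrow> w \<in> lists X \<Longrightarrow> g w = act (loc X g) w"
proof (induction w rule: rev_induct)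
  case Nil
  then show ?case using aut_nil[of g X] by simp
next
  case (snoc x w)
  then show ?case using aut_snoc[of g X w x] by (simp add: act_snoc)
qed

lemma aut_length: "g \<in> tree_auts X \<Longrightarrow> w \<in> lists X \<Longrightarrow> length (g w) = length w"
  by (simp add: aut_act[of g X w])

lemma loc_portrait:
  assumes g: "g \<in> tree_auts X"
  shows "portrait X (loc X g)"
  unfolding portrait_def
proof (intro ballI bij_imp_permutes)
  fix v assume v: "v \<in> lists X"
  show "bij_betw (loc X g v) X X"
    unfolding bij_betw_def
  proof (intro conjI inj_onI equalityI subsetI)
    fix x y assume xy: "x \<in> X" "y \<in> X" "loc X g v x = loc X g v y"
    then have "g (v @ [x]) = g (v @ [y])"
      using aut_snoc[OF g v xy(1)] aut_snoc[OF g v xy(2)] by simp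
    then show "x = y" using aut_inj[OF g, of "v @ [x]" "v @ [y]"] v xy(1,2) by simp
  next
    fix y assume "y \<in> loc X g v ` X"
    then obtain x where "x \<in> X" "y = last (g (v @ [x]))" by (auto simp: loc_def)
    then show "y \<in> X" using aut_snoc_ex[OF g v, of x] by auto
  next
    fix y assume y: "y \<in> X"
    then have "g v @ [y] \<in> lists X" using aut_closed[OF g v] by auto
    then obtain w where w: "w \<in> lists X" "g w = g v @ [y]" using aut_surj[OF g] by blast
    then have "length w = Suc (length v)"
      using aut_length[OF g v] aut_length[OF g w(1)] by simp
    then obtain w' x where wx: "w = w' @ [x]" by (metis length_Suc_conv_rev)
    then have w': "w' \<in> lists X" "x \<in> X" using w(1) by simp_all
    have "g w' @ [loc X g w' x] = g v @ [y]"
      using aut_snoc[OF g w'] w(2) wx by simp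
    then have *: "g w' = g v" "loc X g w' x = y" by simp_all
    then have "w' = v" using aut_inj[OF g w'(1) v] by simp
    then show "y \<in> loc X g v ` X" using * w'(2) by blast
  qed
qed (auto simp: loc_def)

lemma loc_permutes: "g \<in> tree_auts X \<Longrightarrow> v \<in> lists X \<Longrightarrow> loc X g v permutes X"
  using loc_portrait by (auto simp: portrait_def)

lemma aut_eqI:
  assumes "g \<in> tree_auts X" "h \<in> tree_auts X" "\<And>w. w \<in> lists X \<Longrightarrow> g w = h w"
  shows "g = h"
  using Bij_imp_extensional[OF aut_Bij[OF assms(1)]] Bij_imp_extensional[OF aut_Bij[OF assms(2)]]
    assms(3) by (rule extensionalityI)

lemma aut_eq_locI:
  assumes "g \<in> tree_auts X" "h \<in> tree_auts X" "\<And>v. v \<in> lists X \<Longrightarrow> loc X g v = loc X h v"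
  shows "g = h"
proof (rule aut_eqI[OF assms(1,2)])
  fix w assume w: "w \<in> lists X"
  show "g w = h w"
    unfolding aut_act[OF assms(1) w] aut_act[OF assms(2) w] by (rule act_cong[OF assms(3) w])
qed

lemma carrier_AutTree [simp]: "carrier (AutTree X) = tree_auts X"
  by (simp add: AutTree_def)

lemma mult_apply:
  "f \<in> tree_auts X \<Longrightarrow> g \<in> tree_auts X \<Longrightarrow> w \<in> lists X \<Longrightarrow> (f \<otimes>\<^bsub>AutTree X\<^esub> g) w = f (g w)"
  by (simp add: AutTree_def BijGroup_def aut_Bij compose_eq)

lemma one_apply: "w \<in> lists X \<Longrightarrow> \<one>\<^bsub>AutTree X\<^esub> w = w"
  by (simp add: AutTree_def BijGroup_def)

lemma mult_in:
  "f \<in> tree_auts X \<Longrightarrow> g \<in> tree_auts X \<Longrightarrow> f \<otimes>\<^bsub>AutTree X\<^esub> g \<in> tree_auts X"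
  using monoid.m_closed[OF group.is_monoid[OF group_AutTree[of X]]] by simp

lemma one_in: "\<one>\<^bsub>AutTree X\<^esub> \<in> tree_auts X"
  using monoid.one_closed[OF group.is_monoid[OF group_AutTree[of X]]] by simp

lemma inv_in: "g \<in> tree_auts X \<Longrightarrow> inv\<^bsub>AutTree X\<^esub> g \<in> tree_auts X"
  using group.inv_closed[OF group_AutTree[of X]] by simp

lemma loc_mult:
  assumes "f \<in> tree_auts X" "g \<in> tree_auts X" "v \<in> lists X"
  shows "loc X (f \<otimes>\<^bsub>AutTree X\<^esub> g) v = loc X f (g v) \<circ> loc X g v"
proof
  fix x
  show "loc X (f \<otimes>\<^bsub>AutTree X\<^esub> g) v x = (loc X f (g v) \<circ> loc X g v) x"
  proof (cases "x \<in> X")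
    case True
    have "loc X g v x \<in> X" using loc_permutes[OF assms(2,3)] True by (simp add: permutes_in_image)
    then show ?thesis
      using True assms(3) aut_snoc[OF assms(2,3) True]
        aut_snoc[OF assms(1) aut_closed[OF assms(2,3)], of "loc X g v x"]
      by (simp add: loc_def[of X "f \<otimes>\<^bsub>AutTree X\<^esub> g"] mult_apply[OF assms(1,2)])
  qed (simp add: loc_def)
qed

lemma loc_one: "v \<in> lists X \<Longrightarrow> loc X \<one>\<^bsub>AutTree X\<^esub> v = id"
  by (rule ext) (auto simp: loc_def one_apply)

lemma inv_apply:
  assumes "g \<in> tree_auts X" "w \<in> lists X"
  shows "(inv\<^bsub>AutTree X\<^esub> g) (g w) = w"
proof -
  have "(inv\<^bsub>AutTree X\<^esub> g \<otimes>\<^bsub>AutTree X\<^esub> g) w = w"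
    using group.l_inv[OF group_AutTree[of X]] assms by (simp add: one_apply)
  then show ?thesis using assms by (simp add: mult_apply inv_in)
qed

lemma loc_inv:
  assumes "g \<in> tree_auts X" "v \<in> lists X"
  shows "loc X (inv\<^bsub>AutTree X\<^esub> g) (g v) \<circ> loc X g v = id"
proof -
  have "loc X (inv\<^bsub>AutTree X\<^esub> g \<otimes>\<^bsub>AutTree X\<^esub> g) v = id"
    using group.l_inv[OF group_AutTree[of X]] assms by (simp add: loc_one)
  then show ?thesis using assms by (simp add: loc_mult inv_in)
qed

section \<open>Sections, grafts and masks\<close>

text \<open>\<open>sect\<close> is the action of \<open>g\<close> on the subtree below \<open>v\<close>, with both this subtree and the one below
  \<open>g v\<close> identified with the whole tree; \<open>graft\<close> is the copy of \<open>h\<close> acting below \<open>v\<close>; and \<open>mask\<close> keeps the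
  portrait of \<open>g\<close> on \<open>S\<close> and forgets the rest. Masks are the partial products by which an automorphism
  is decomposed into copies of its sections.\<close>

definition sect :: "'x set \<Rightarrow> 'x list \<Rightarrow> ('x list \<Rightarrow> 'x list) \<Rightarrow> 'x list \<Rightarrow> 'x list" where
  "sect X v g = portrait_aut X (\<lambda>u. loc X g (v @ u))"

definition graft :: "'x set \<Rightarrow> 'x list \<Rightarrow> ('x list \<Rightarrow> 'x list) \<Rightarrow> 'x list \<Rightarrow> 'x list" where
  "graft X v h =
     portrait_aut X (\<lambda>w. if take (length v) w = v then loc X h (drop (length v) w) else id)"

definition mask :: "'x set \<Rightarrow> 'x list set \<Rightarrow> ('x list \<Rightarrow> 'x list) \<Rightarrow> 'x list \<Rightarrow> 'x list" where
  "mask X S g = portrait_aut X (\<lambda>w. if w \<in> S then loc X g w else id)"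

lemma take_eq_iff_append: "take (length v) w = v \<longleftrightarrow> (\<exists>u. w = v @ u)"
  by (metis append_eq_conv_conj append_take_drop_id)

lemma in_subtree: "w \<in> lists X \<Longrightarrow> w \<in> subtree X v \<longleftrightarrow> take (length v) w = v"
  unfolding take_eq_iff_append by (auto simp: subtree_def)

lemma sect_portrait: "g \<in> tree_auts X \<Longrightarrow> v \<in> lists X \<Longrightarrow> portrait X (\<lambda>u. loc X g (v @ u))"
  by (rule portrait_shift[OF loc_portrait])

lemma sect_in: "g \<in> tree_auts X \<Longrightarrow> v \<in> lists X \<Longrightarrow> sect X v g \<in> tree_auts X"
  unfolding sect_def by (rule portrait_aut_in[OF sect_portrait])

lemma loc_sect:
  "g \<in> tree_auts X \<Longrightarrow> v \<in> lists X \<Longrightarrow> u \<in> lists X \<Longrightarrow> loc X (sect X v g) u = loc X g (v @ u)"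
  unfolding sect_def by (rule loc_portrait_aut[OF sect_portrait])

lemma sect_apply:
  assumes "g \<in> tree_auts X" "v \<in> lists X" "u \<in> lists X"
  shows "g (v @ u) = g v @ sect X v g u"
  using assms aut_act[OF assms(1), of "v @ u"] aut_act[OF assms(1,2)]
  by (simp add: act_append sect_def portrait_aut_apply)

lemma graft_portrait:
  assumes "h \<in> tree_auts X"
  shows "portrait X (\<lambda>w. if take (length v) w = v then loc X h (drop (length v) w) else id)"
  unfolding portrait_def
  using loc_permutes[OF assms]
  by (auto simp: permutes_id)

lemma graft_in: "h \<in> tree_auts X \<Longrightarrow> graft X v h \<in> tree_auts X"
  unfolding graft_def by (rule portrait_aut_in[OF graft_portrait])

lemma loc_graft:
  assumes "h \<in> tree_auts X" "w \<in> lists X"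
  shows "loc X (graft X v h) w = (if take (length v) w = v then loc X h (drop (length v) w) else id)"
  unfolding graft_def by (rule loc_portrait_aut[OF graft_portrait[OF assms(1)] assms(2)])

lemma loc_graft_below:
  assumes "h \<in> tree_auts X" "v \<in> lists X" "u \<in> lists X"
  shows "loc X (graft X v h) (v @ u) = loc X h u"
  using assms by (subst loc_graft) auto

lemma graft_off:
  assumes "h \<in> tree_auts X" "w \<in> lists X" "\<nexists>u. u \<noteq> [] \<and> w = v @ u"
  shows "graft X v h w = w"
proof -
  have "act (\<lambda>w. if take (length v) w = v then loc X h (drop (length v) w) else id) w = w"
  proof (rule act_id)
    fix u s assume us: "w = u @ s" "s \<noteq> []"
    have "take (length v) u \<noteq> v"
    proof
      assume "take (length v) u = v"
      then obtain a where "u = v @ a" unfolding take_eq_iff_append by blast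
      then have "a @ s \<noteq> [] \<and> w = v @ (a @ s)" using us by simp
      then show False using assms(3) by blast
    qed
    then show "(if take (length v) u = v then loc X h (drop (length v) u) else id) = id" by simp
  qed
  then show ?thesis using assms(2) by (simp add: graft_def portrait_aut_apply)
qed

lemma graft_below:
  assumes "h \<in> tree_auts X" "v \<in> lists X" "u \<in> lists X"
  shows "graft X v h (v @ u) = v @ h u"
proof -
  have "act (loc X (graft X v h)) v = v"
    using graft_off[OF assms(1,2)] aut_act[OF graft_in[OF assms(1)] assms(2)] by simp
  moreover have "act (\<lambda>u. loc X (graft X v h) (v @ u)) u = act (loc X h) u"
    using assms(3) by (intro act_cong[of X] loc_graft_below assms(1,2))
  ultimately show ?thesis
    using assms aut_act[OF graft_in[OF assms(1)], of "v @ u" v] aut_act[OF assms(1,3)]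
    by (simp add: act_append)
qed

lemma graft_not_below:
  "h \<in> tree_auts X \<Longrightarrow> w \<in> lists X \<Longrightarrow> take (length v) w \<noteq> v \<Longrightarrow> graft X v h w = w"
  unfolding take_eq_iff_append by (rule graft_off) auto

lemma graft_mult:
  assumes g: "g \<in> tree_auts X" and h: "h \<in> tree_auts X" and v: "v \<in> lists X"
  shows "graft X v (g \<otimes>\<^bsub>AutTree X\<^esub> h) = graft X v g \<otimes>\<^bsub>AutTree X\<^esub> graft X v h"
proof (rule aut_eqI)
  fix w assume w: "w \<in> lists X"
  show "graft X v (g \<otimes>\<^bsub>AutTree X\<^esub> h) w = (graft X v g \<otimes>\<^bsub>AutTree X\<^esub> graft X v h) w"
  proof (cases "take (length v) w = v")
    case True
    then obtain u where u: "w = v @ u" unfolding take_eq_iff_append by blast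
    then show ?thesis using w g h v
      by (simp add: mult_apply graft_in graft_below mult_in aut_closed)
  next
    case False
    then show ?thesis using w g h
      by (simp add: mult_apply graft_in graft_not_below mult_in)
  qed
qed (use g h in \<open>auto intro!: graft_in mult_in\<close>)

lemma graft_one: "v \<in> lists X \<Longrightarrow> graft X v \<one>\<^bsub>AutTree X\<^esub> = \<one>\<^bsub>AutTree X\<^esub>"
proof (rule aut_eq_locI)
  fix w assume "v \<in> lists X" "w \<in> lists X"
  then show "loc X (graft X v \<one>\<^bsub>AutTree X\<^esub>) w = loc X \<one>\<^bsub>AutTree X\<^esub> w"
    by (auto simp: loc_graft one_in loc_one)
qed (auto intro!: graft_in one_in)

lemma graft_commute:
  assumes g: "g \<in> tree_auts X" and h: "h \<in> tree_auts X" and v: "v \<in> lists X" and w: "w \<in> lists X"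
    and vw: "take (length v) w \<noteq> v" "take (length w) v \<noteq> w"
  shows "graft X v g \<otimes>\<^bsub>AutTree X\<^esub> graft X w h = graft X w h \<otimes>\<^bsub>AutTree X\<^esub> graft X v g"
proof (rule aut_eqI)
  have disj: "v @ a \<noteq> w @ b" for a b
    using vw unfolding take_eq_iff_append by (metis append_eq_append_conv2)
  fix z assume z: "z \<in> lists X"
  consider u where "z = v @ u" "u \<in> lists X" | u where "z = w @ u" "u \<in> lists X"
    | "take (length v) z \<noteq> v" "take (length w) z \<noteq> w"
    using z unfolding take_eq_iff_append by auto
  then show "(graft X v g \<otimes>\<^bsub>AutTree X\<^esub> graft X w h) z = (graft X w h \<otimes>\<^bsub>AutTree X\<^esub> graft X v g) z"
  proof cases
    case 1
    have "take (length w) (v @ t) \<noteq> w" for t using disj unfolding take_eq_iff_append by auto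
    with 1 show ?thesis using z g h v w
      by (simp add: mult_apply graft_in graft_below graft_not_below aut_closed)
  next
    case 2
    have "take (length v) (w @ t) \<noteq> v" for t using disj unfolding take_eq_iff_append by metis
    with 2 show ?thesis using z g h v w
      by (simp add: mult_apply graft_in graft_below graft_not_below aut_closed)
  next
    case 3
    then show ?thesis using z g h by (simp add: mult_apply graft_in graft_not_below)
  qed
qed (use g h in \<open>auto intro!: graft_in mult_in\<close>)

lemma graft_conj:
  assumes p: "p \<in> tree_auts X" and h: "h \<in> tree_auts X" and v: "v \<in> lists X" and w: "w \<in> lists X"
    and pvw: "\<And>u. u \<in> lists X \<Longrightarrow> p (v @ u) = w @ u"
  shows "p \<otimes>\<^bsub>AutTree X\<^esub> graft X v h = graft X w h \<otimes>\<^bsub>AutTree X\<^esub> p"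
proof (rule aut_eqI)
  fix z assume z: "z \<in> lists X"
  show "(p \<otimes>\<^bsub>AutTree X\<^esub> graft X v h) z = (graft X w h \<otimes>\<^bsub>AutTree X\<^esub> p) z"
  proof (cases "take (length v) z = v")
    case True
    then obtain u where u: "z = v @ u" unfolding take_eq_iff_append by blast
    then show ?thesis using z p h v w
      by (simp add: mult_apply graft_in graft_below pvw aut_closed)
  next
    case False
    have "take (length w) (p z) \<noteq> w"
    proof
      assume "take (length w) (p z) = w"
      then obtain u where u: "p z = w @ u" unfolding take_eq_iff_append by blast
      then have "u \<in> lists X" using aut_closed[OF p z] by auto
      then have "p z = p (v @ u)" using pvw u by simp
      then have "z = v @ u" using aut_inj[OF p z, of "v @ u"] v \<open>u \<in> lists X\<close> by auto
      then show False using False by simp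
    qed
    then show ?thesis using False z p h by (simp add: mult_apply graft_in graft_not_below aut_closed)
  qed
qed (use p h in \<open>auto intro!: graft_in mult_in\<close>)

lemma sect_mult:
  assumes g: "g \<in> tree_auts X" and h: "h \<in> tree_auts X" and v: "v \<in> lists X"
  shows "sect X v (g \<otimes>\<^bsub>AutTree X\<^esub> h) = sect X (h v) g \<otimes>\<^bsub>AutTree X\<^esub> sect X v h"
proof (rule aut_eqI)
  fix w assume w: "w \<in> lists X"
  have hv: "h v \<in> lists X" and sw: "sect X v h w \<in> lists X"
    using aut_closed[OF h v] aut_closed[OF sect_in[OF h v] w] .
  have "g (h v) @ sect X v (g \<otimes>\<^bsub>AutTree X\<^esub> h) w = (g \<otimes>\<^bsub>AutTree X\<^esub> h) (v @ w)"
    unfolding sect_apply[OF mult_in[OF g h] v w] mult_apply[OF g h v] ..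
  also have "\<dots> = g (h (v @ w))"
    by (rule mult_apply[OF g h]) (simp add: v w)
  also have "\<dots> = g (h v) @ sect X (h v) g (sect X v h w)"
    unfolding sect_apply[OF h v w] sect_apply[OF g hv sw] ..
  also have "sect X (h v) g (sect X v h w) = (sect X (h v) g \<otimes>\<^bsub>AutTree X\<^esub> sect X v h) w"
    by (rule mult_apply[OF sect_in[OF g hv] sect_in[OF h v] w, symmetric])
  finally show "sect X v (g \<otimes>\<^bsub>AutTree X\<^esub> h) w = (sect X (h v) g \<otimes>\<^bsub>AutTree X\<^esub> sect X v h) w"
    by simp
qed (simp_all add: sect_in mult_in g h v aut_closed[OF h v])

lemma mask_portrait: "g \<in> tree_auts X \<Longrightarrow> portrait X (\<lambda>w. if w \<in> S then loc X g w else id)"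
  using loc_permutes[of g X] by (auto simp: portrait_def permutes_id)

lemma mask_in: "g \<in> tree_auts X \<Longrightarrow> mask X S g \<in> tree_auts X"
  unfolding mask_def by (rule portrait_aut_in[OF mask_portrait])

lemma loc_mask:
  "g \<in> tree_auts X \<Longrightarrow> w \<in> lists X \<Longrightarrow> loc X (mask X S g) w = (if w \<in> S then loc X g w else id)"
  unfolding mask_def by (rule loc_portrait_aut[OF mask_portrait])

text \<open>The assumptions say that the mask is the identity on the whole subtree below \<open>v\<close>, so the grafted
  section supplies exactly the missing part of the portrait.\<close>

lemma mask_Un_subtree:
  assumes g: "g \<in> tree_auts X" and v: "v \<in> lists X" and S: "S \<inter> subtree X v = {}"
    and fix_v: "mask X S g v = v"
  shows "mask X (S \<union> subtree X v) g = graft X v (sect X v g) \<otimes>\<^bsub>AutTree X\<^esub> mask X S g"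
proof (rule aut_eq_locI)
  let ?m = "mask X S g"
  fix w assume w: "w \<in> lists X"
  have m: "?m \<in> tree_auts X" using g by (rule mask_in)
  have below: "?m (v @ u) = v @ u" if u: "u \<in> lists X" for u
  proof -
    have "loc X ?m (v @ t) = id" if t: "t \<in> lists X" for t
    proof -
      have "v @ t \<in> subtree X v" using t unfolding subtree_def by blast
      then have "v @ t \<notin> S" using S by blast
      then show ?thesis using loc_mask[OF g, of "v @ t" S] v t by simp
    qed
    then have "act (\<lambda>t. loc X ?m (v @ t)) u = act (\<lambda>t. id) u" by (rule act_cong[OF _ u])
    moreover have "?m (v @ u) = act (loc X ?m) (v @ u)" using aut_act[OF m] u v by simp
    moreover have "act (loc X ?m) v = v" using aut_act[OF m v] fix_v by simp
    ultimately show ?thesis by (simp add: act_append)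
  qed
  show "loc X (mask X (S \<union> subtree X v) g) w
      = loc X (graft X v (sect X v g) \<otimes>\<^bsub>AutTree X\<^esub> ?m) w"
  proof (cases "take (length v) w = v")
    case True
    then obtain u where u: "w = v @ u" unfolding take_eq_iff_append by blast
    moreover have u': "u \<in> lists X" using u w by simp
    moreover have sub: "w \<in> subtree X v" using True w by (simp add: in_subtree)
    moreover have "w \<notin> S" using sub S by blast
    ultimately show ?thesis
      using loc_mult[OF graft_in[OF sect_in[OF g v], of v] m w] loc_mask[OF g w]
        loc_graft_below[OF sect_in[OF g v] v u'] loc_sect[OF g v u'] below[OF u']
      by simp
  next
    case False
    have "take (length v) (?m w) \<noteq> v"
    proof
      assume "take (length v) (?m w) = v"
      then obtain u where u: "?m w = v @ u" unfolding take_eq_iff_append by blast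
      then have uX: "u \<in> lists X" using aut_closed[OF m w] by simp
      have "?m w = ?m (v @ u)" using below[OF uX] u by simp
      then have "w = v @ u" using aut_inj[OF m w, of "v @ u"] v uX by simp
      then show False using False by simp
    qed
    then show ?thesis
      using False loc_mult[OF graft_in[OF sect_in[OF g v], of v] m w] loc_mask[OF g w]
        loc_graft[OF sect_in[OF g v] aut_closed[OF m w], of v] in_subtree[OF w]
      by simp
  qed
qed (simp_all add: mask_in graft_in sect_in mult_in g v)

section \<open>Finitary automorphisms\<close>

definition finitary :: "'x set \<Rightarrow> ('x list \<Rightarrow> 'x list) set" where
  "finitary X = {g \<in> tree_auts X. \<exists>n. \<forall>v\<in>lists X. n \<le> length v \<longrightarrow> loc X g v = id}"

lemma finitary_inv:
  assumes "g \<in> finitary X"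
  shows "inv\<^bsub>AutTree X\<^esub> g \<in> finitary X"
proof -
  obtain n where g: "g \<in> tree_auts X" and n: "\<forall>v\<in>lists X. n \<le> length v \<longrightarrow> loc X g v = id"
    using assms by (auto simp: finitary_def)
  have "loc X (inv\<^bsub>AutTree X\<^esub> g) w = id" if w: "w \<in> lists X" "n \<le> length w" for w
  proof -
    obtain v where "v \<in> lists X" "g v = w" using aut_surj[OF g w(1)] by blast
    then show ?thesis using loc_inv[OF g, of v] n w(2) aut_length[OF g, of v] by auto
  qed
  then show ?thesis using inv_in[OF g] by (auto simp: finitary_def)
qed

lemma finitary_sect:
  assumes "g \<in> finitary X" "v \<in> lists X"
  shows "sect X v g \<in> finitary X"
proof -
  obtain n where g: "g \<in> tree_auts X" and n: "\<forall>v\<in>lists X. n \<le> length v \<longrightarrow> loc X g v = id"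
    using assms by (auto simp: finitary_def)
  then have "\<forall>u\<in>lists X. n \<le> length u \<longrightarrow> loc X (sect X v g) u = id"
    using assms(2) by (auto simp: loc_sect)
  then show ?thesis using sect_in[OF g assms(2)] by (auto simp: finitary_def)
qed

lemma finitary_graft:
  assumes "g \<in> finitary X" "v \<in> lists X"
  shows "graft X v g \<in> finitary X"
proof -
  obtain n where g: "g \<in> tree_auts X" and n: "\<forall>v\<in>lists X. n \<le> length v \<longrightarrow> loc X g v = id"
    using assms by (auto simp: finitary_def)
  have "loc X (graft X v g) u = id" if u: "u \<in> lists X" "n + length v \<le> length u" for u
    using u n by (auto simp: loc_graft[OF g])
  then show ?thesis using graft_in[OF g] by (auto simp: finitary_def)
qed

text \<open>The witness exchanges the \<open>i\<close>-th letters of \<open>u\<close> and \<open>v\<close> at every vertex of level \<open>i\<close>. That it acts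
  rigidly below \<open>u\<close> makes conjugation by it move a copy at one vertex to the same copy at the other.\<close>

lemma finitary_transport:
  assumes "u \<in> level X n" "v \<in> level X n"
  obtains p where "p \<in> finitary X" "\<And>w. w \<in> lists X \<Longrightarrow> p (u @ w) = v @ w"
proof -
  let ?q = "\<lambda>u v t. if length t < length u then Transposition.transpose (u ! length t) (v ! length t) else id"
  have uv: "u \<in> lists X" "v \<in> lists X" "length u = length v" using assms by (auto simp: level_def)
  have pq: "portrait X (?q u v)"
    unfolding portrait_def
  proof
    fix t
    show "?q u v t permutes X"
    proof (cases "length t < length u")
      case True
      then have "u ! length t \<in> X" "v ! length t \<in> X"
        using uv by (simp_all add: in_lists_conv_set)
      then show ?thesis using True by (simp add: permutes_swap_id)
    qed (simp add: permutes_id)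
  qed
  have "act (?q u v) u = v"
    using uv(3)
  proof (induction u v rule: list_induct2)
    case (Cons x xs y ys)
    have "act (?q (x # xs) (y # ys)) (x # xs) = y # act (?q xs ys) xs"
      by (simp cong: if_cong)
    then show ?case using Cons.IH by simp
  qed simp
  moreover have "act (\<lambda>t. ?q u v (u @ t)) w = w" for w by simp
  ultimately have below: "portrait_aut X (?q u v) (u @ w) = v @ w" if "w \<in> lists X" for w
    using portrait_aut_apply[of "u @ w" X "?q u v"] that uv(1) by (simp add: act_append)
  have "loc X (portrait_aut X (?q u v)) t = id" if "t \<in> lists X" "length u \<le> length t" for t
    using loc_portrait_aut[OF pq that(1)] that(2) by simp
  then have "portrait_aut X (?q u v) \<in> finitary X"
    unfolding finitary_def using portrait_aut_in[OF pq] by blast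
  then show thesis using below by (rule that)
qed

section \<open>Directed automorphisms of the ternary tree\<close>

definition letters :: "nat set" where
  "letters = {0, 1, 2}"

abbreviation Aut3 :: "(nat list \<Rightarrow> nat list) monoid" where
  "Aut3 \<equiv> AutTree letters"

interpretation Aut3: group Aut3
  by (rule group_AutTree)

definition off_spine :: "nat list \<Rightarrow> bool" where
  "off_spine v \<longleftrightarrow> (\<exists>k. v = replicate k 0 @ [1])"

definition directed :: "(nat \<Rightarrow> nat) \<Rightarrow> nat list \<Rightarrow> nat list" where
  "directed x = portrait_aut letters (\<lambda>v. if off_spine v then x else id)"

lemma finite_letters: "finite letters"
  by (simp add: letters_def)

lemma zeros_level: "replicate n 0 \<in> level letters n"
  by (auto simp: level_def letters_def in_lists_conv_set)

lemma zeros_in_lists [simp]: "replicate n 0 \<in> lists letters"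
  by (auto simp: letters_def in_lists_conv_set)

lemma off_spine_in_lists: "off_spine v \<Longrightarrow> v \<in> lists letters"
  by (auto simp: off_spine_def letters_def in_lists_conv_set)

lemma off_spine_zeros_append: "off_spine (replicate n 0 @ u) \<longleftrightarrow> off_spine u"
proof
  assume "off_spine (replicate n 0 @ u)"
  then obtain k where k: "replicate n 0 @ u = replicate k 0 @ [1 :: nat]"
    by (auto simp: off_spine_def)
  have "n \<le> k"
  proof (rule ccontr)
    assume "\<not> n \<le> k"
    then have "(replicate n 0 @ u) ! k = 0" by (simp add: nth_append)
    then show False using k by (simp add: nth_append)
  qed
  then have "replicate k (0::nat) = replicate n 0 @ replicate (k - n) 0"
    by (simp flip: replicate_add)
  then show "off_spine u" using k by (auto simp: off_spine_def)
next
  assume "off_spine u"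
  then obtain k where "u = replicate k 0 @ [1]" by (auto simp: off_spine_def)
  then have "replicate n 0 @ u = replicate (n + k) 0 @ [1]" by (simp add: replicate_add)
  then show "off_spine (replicate n 0 @ u)" unfolding off_spine_def by blast
qed

text \<open>The nontrivial vertices of a directed automorphism form an antichain. Therefore such an
  automorphism fixes each of them, and directed automorphisms multiply like the permutations that they carry.\<close>

lemma off_spine_below_off_spine:
  assumes "off_spine u" "s \<noteq> []"
  shows "\<not> off_spine (u @ s)"
proof
  assume "off_spine (u @ s)"
  moreover obtain k where "u = replicate k 0 @ [1]" using assms(1) by (auto simp: off_spine_def)
  ultimately have "off_spine ([1] @ s)" by (simp add: off_spine_zeros_append)
  then obtain k where k: "[1] @ s = replicate k 0 @ [1]" by (auto simp: off_spine_def)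
  then show False using assms(2) by (cases k) auto
qed

lemma not_off_spine_zeros: "\<not> off_spine (replicate k 0)"
  using off_spine_zeros_append[of k "[]"] by (simp add: off_spine_def)

lemma directed_portrait:
  "x permutes letters \<Longrightarrow> portrait letters (\<lambda>v. if off_spine v then x else id)"
  by (simp add: portrait_def permutes_id)

lemma directed_in: "x permutes letters \<Longrightarrow> directed x \<in> tree_auts letters"
  unfolding directed_def by (intro portrait_aut_in directed_portrait)

lemma loc_directed:
  "x permutes letters \<Longrightarrow> v \<in> lists letters \<Longrightarrow> loc letters (directed x) v = (if off_spine v then x else id)"
  unfolding directed_def by (subst loc_portrait_aut[OF directed_portrait]) simp_all

lemma directed_fixes_off_spine:
  assumes "off_spine v"
  shows "directed x v = v"
proof -
  have "act (\<lambda>v. if off_spine v then x else id) v = v"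
    using assms off_spine_below_off_spine by (intro act_id) auto
  then show ?thesis by (simp add: directed_def portrait_aut_apply off_spine_in_lists assms)
qed

lemma directed_off_spine_iff:
  assumes x: "x permutes letters" and v: "v \<in> lists letters"
  shows "off_spine (directed x v) \<longleftrightarrow> off_spine v"
proof
  assume off: "off_spine (directed x v)"
  then have "directed x (directed x v) = directed x v" by (rule directed_fixes_off_spine)
  then have "directed x v = v"
    using aut_inj[OF directed_in[OF x] off_spine_in_lists[OF off] v] by simp
  then show "off_spine v" using off by simp
qed (simp add: directed_fixes_off_spine)

lemma directed_mult:
  assumes x: "x permutes letters" and y: "y permutes letters"
  shows "directed x \<otimes>\<^bsub>Aut3\<^esub> directed y = directed (x \<circ> y)"
proof (rule aut_eq_locI)
  fix v assume v: "v \<in> lists letters"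
  show "loc letters (directed x \<otimes>\<^bsub>Aut3\<^esub> directed y) v = loc letters (directed (x \<circ> y)) v"
    using loc_mult[OF directed_in[OF x] directed_in[OF y] v]
      loc_directed[OF x aut_closed[OF directed_in[OF y] v]] loc_directed[OF y v]
      loc_directed[OF permutes_compose[OF y x] v] directed_off_spine_iff[OF y v]
    by simp
qed (simp_all add: mult_in directed_in x y permutes_compose)

lemma directed_id: "directed id = \<one>\<^bsub>Aut3\<^esub>"
  by (rule aut_eq_locI[of _ letters])
     (simp_all add: directed_in permutes_id one_in loc_one loc_directed)

lemma aut_fixI:
  assumes "g \<in> tree_auts X" "v \<in> lists X" "\<And>u s. v = u @ s \<Longrightarrow> s \<noteq> [] \<Longrightarrow> loc X g u = id"
  shows "g v = v"
  using aut_act[OF assms(1,2)] act_id[of v "loc X g", OF assms(3)] by simp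

lemma loc_graft_directed:
  assumes x: "x permutes letters" and v: "v \<in> lists letters" "n < length v"
  shows "loc letters (graft letters (replicate n 0) (directed x)) v = (if off_spine v then x else id)"
proof (cases "take n v = replicate n 0")
  case True
  then obtain u where u: "v = replicate n 0 @ u" by (metis append_take_drop_id)
  then have "u \<in> lists letters" using v by simp
  then show ?thesis unfolding u off_spine_zeros_append
    using loc_graft_below[OF directed_in[OF x] zeros_in_lists] loc_directed[OF x] by simp
next
  case False
  have "\<not> off_spine v"
  proof
    assume "off_spine v"
    then obtain k where k: "v = replicate k 0 @ [1]" by (auto simp: off_spine_def)
    with v(2) have "n \<le> k" by simp
    then have "take n v = replicate n 0" using k by simp
    then show False using False by simp
  qed
  then show ?thesis using False by (simp add: loc_graft directed_in x v(1))
qed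

text \<open>The finitary factor collects the finitely many nontrivial vertices off the spine above level
  \<open>n\<close>. This is the reason why subgroups containing the finitary automorphisms cannot distinguish a
  directed automorphism from its copies at deeper vertices.\<close>

lemma directed_split:
  assumes x: "x permutes letters"
  obtains p where "p \<in> finitary letters"
    "directed x = graft letters (replicate n 0) (directed x) \<otimes>\<^bsub>Aut3\<^esub> p"
proof
  let ?z = "replicate n (0::nat)" and ?d = "directed x"
  let ?S = "- subtree letters ?z"
  have d: "?d \<in> tree_auts letters" using x by (rule directed_in)
  have S: "w \<in> ?S \<longleftrightarrow> take n w \<noteq> ?z" if "w \<in> lists letters" for w
    using in_subtree[OF that, of ?z] by simp
  have "loc letters (mask letters ?S ?d) v = id" if v: "v \<in> lists letters" "Suc n \<le> length v" for v
  proof -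
    have "off_spine v \<Longrightarrow> take n v = ?z" using v(2) by (auto simp: off_spine_def)
    then show ?thesis using loc_mask[OF d v(1)] S[OF v(1)] loc_directed[OF x v(1)] by auto
  qed
  then show "mask letters ?S ?d \<in> finitary letters"
    unfolding finitary_def using mask_in[OF d] by blast
  have "mask letters ?S ?d ?z = ?z"
  proof (rule aut_fixI[OF mask_in[OF d] zeros_in_lists])
    fix u s assume us: "?z = u @ s" "s \<noteq> []"
    then have "take (length u) ?z = u" by simp
    then have uz: "u = replicate (length u) 0" by (metis length_replicate take_replicate)
    then have "\<not> off_spine u" using not_off_spine_zeros by metis
    moreover have "u \<in> lists letters" using uz zeros_in_lists by metis
    ultimately show "loc letters (mask letters ?S ?d) u = id"
      using loc_mask[OF d] loc_directed[OF x] by simp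
  qed
  then have "mask letters (?S \<union> subtree letters ?z) ?d
      = graft letters ?z (sect letters ?z ?d) \<otimes>\<^bsub>Aut3\<^esub> mask letters ?S ?d"
    by (intro mask_Un_subtree[OF d]) auto
  moreover have "mask letters (?S \<union> subtree letters ?z) ?d = ?d"
    by (rule aut_eq_locI[OF mask_in[OF d] d]) (simp add: loc_mask[OF d])
  moreover have "sect letters ?z ?d = ?d"
    by (rule aut_eq_locI[OF sect_in[OF d] d])
       (simp_all add: loc_sect[OF d] loc_directed[OF x] off_spine_zeros_append)
  ultimately show "?d = graft letters ?z ?d \<otimes>\<^bsub>Aut3\<^esub> mask letters ?S ?d" by simp
qed

section \<open>Subgroups containing all finitary automorphisms\<close>

lemma graft_mem_transport:
  assumes M: "subgroup M Aut3" and fin: "finitary letters \<subseteq> M" and h: "h \<in> tree_auts letters"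
    and vw: "v \<in> level letters n" "w \<in> level letters n" and mem: "graft letters v h \<in> M"
  shows "graft letters w h \<in> M"
proof -
  obtain p where p: "p \<in> finitary letters" "\<And>u. u \<in> lists letters \<Longrightarrow> p (v @ u) = w @ u"
    using finitary_transport[OF vw] by blast
  have pT: "p \<in> tree_auts letters" using p(1) by (simp add: finitary_def)
  have v: "v \<in> lists letters" and w: "w \<in> lists letters" using vw by (simp_all add: level_def)
  have "p \<otimes>\<^bsub>Aut3\<^esub> graft letters v h = graft letters w h \<otimes>\<^bsub>Aut3\<^esub> p"
    by (rule graft_conj[OF pT h v w p(2)])
  then have "graft letters w h = p \<otimes>\<^bsub>Aut3\<^esub> graft letters v h \<otimes>\<^bsub>Aut3\<^esub> inv\<^bsub>Aut3\<^esub> p"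
    using Aut3.inv_solve_right'[of "graft letters w h" "p \<otimes>\<^bsub>Aut3\<^esub> graft letters v h" p]
      pT graft_in[OF h] by (simp add: mult_in)
  moreover have "p \<in> M" using p(1) fin by blast
  ultimately show ?thesis
    using mem subgroup.m_closed[OF M] subgroup.m_inv_closed[OF M] by simp
qed

lemma graft_directed_mem_iff:
  assumes M: "subgroup M Aut3" and fin: "finitary letters \<subseteq> M" and x: "x permutes letters"
    and v: "v \<in> lists letters"
  shows "graft letters v (directed x) \<in> M \<longleftrightarrow> directed x \<in> M"
proof -
  let ?g = "graft letters (replicate (length v) 0) (directed x)"
  obtain p where p: "p \<in> finitary letters" "directed x = ?g \<otimes>\<^bsub>Aut3\<^esub> p"
    using directed_split[OF x] by blast
  have g: "?g \<in> tree_auts letters" by (rule graft_in[OF directed_in[OF x]])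
  have pM: "p \<in> M" and pT: "p \<in> tree_auts letters" using p(1) fin by (auto simp: finitary_def)
  have "?g \<in> M \<longleftrightarrow> directed x \<in> M"
  proof
    assume "directed x \<in> M"
    moreover have "?g = directed x \<otimes>\<^bsub>Aut3\<^esub> inv\<^bsub>Aut3\<^esub> p"
      using p(2) g pT directed_in[OF x] Aut3.inv_solve_right'[of ?g "directed x" p] by simp
    ultimately show "?g \<in> M"
      using pM subgroup.m_closed[OF M] subgroup.m_inv_closed[OF M] by simp
  next
    assume "?g \<in> M"
    then have "?g \<otimes>\<^bsub>Aut3\<^esub> p \<in> M" using pM by (rule subgroup.m_closed[OF M])
    then show "directed x \<in> M" unfolding p(2)[symmetric] .
  qed
  moreover have "v \<in> level letters (length v)" using v by (simp add: level_def)
  ultimately show ?thesis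
    using graft_mem_transport[OF M fin directed_in[OF x]] zeros_level by blast
qed

section \<open>The group\<close>

definition swap01 :: "nat \<Rightarrow> nat" where "swap01 = Transposition.transpose 0 1"
definition swap12 :: "nat \<Rightarrow> nat" where "swap12 = Transposition.transpose 1 2"

lemma swap01_permutes: "swap01 permutes letters"
  unfolding swap01_def by (rule permutes_swap_id) (simp_all add: letters_def)

lemma swap12_permutes: "swap12 permutes letters"
  unfolding swap12_def by (rule permutes_swap_id) (simp_all add: letters_def)

definition gens :: "(nat list \<Rightarrow> nat list) set" where
  "gens = finitary letters \<union> {directed swap01, directed swap12}"

definition Grp :: "(nat list \<Rightarrow> nat list) set" where
  "Grp = generate Aut3 gens"

lemma directed_swap_square:
  "directed swap01 \<otimes>\<^bsub>Aut3\<^esub> directed swap01 = \<one>\<^bsub>Aut3\<^esub>"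
  "directed swap12 \<otimes>\<^bsub>Aut3\<^esub> directed swap12 = \<one>\<^bsub>Aut3\<^esub>"
proof -
  have "swap01 \<circ> swap01 = id" "swap12 \<circ> swap12 = id" by (simp_all add: swap01_def swap12_def)
  then show "directed swap01 \<otimes>\<^bsub>Aut3\<^esub> directed swap01 = \<one>\<^bsub>Aut3\<^esub>"
    "directed swap12 \<otimes>\<^bsub>Aut3\<^esub> directed swap12 = \<one>\<^bsub>Aut3\<^esub>"
    by (simp_all add: directed_mult swap01_permutes swap12_permutes directed_id)
qed

lemma gens_subset: "gens \<subseteq> tree_auts letters"
  by (auto simp: gens_def finitary_def directed_in swap01_permutes swap12_permutes)

lemma inv_directed_swap:
  "inv\<^bsub>Aut3\<^esub> (directed swap01) = directed swap01"
  "inv\<^bsub>Aut3\<^esub> (directed swap12) = directed swap12"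
  by (rule Aut3.inv_equality;
      simp add: directed_swap_square directed_in swap01_permutes swap12_permutes)+

lemma gens_inv: "h \<in> gens \<Longrightarrow> inv\<^bsub>Aut3\<^esub> h \<in> gens"
  using finitary_inv by (auto simp: gens_def inv_directed_swap)

lemma subgroup_Grp: "subgroup Grp Aut3"
  unfolding Grp_def using gens_subset by (intro Aut3.generate_is_subgroup) simp

lemma Grp_subset: "g \<in> Grp \<Longrightarrow> g \<in> tree_auts letters"
  using subgroup.subset[OF subgroup_Grp] by auto

lemma gens_subset_Grp: "gens \<subseteq> Grp"
  unfolding Grp_def by (auto intro: generate.incl)

text \<open>If the generators are closed under inversion, then so is their set of products, and induction over
  a generated subgroup needs no case for inverses.\<close>

lemma generate_induct_inv_closed:
  assumes "g \<in> generate G H"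
    and inv: "\<And>h. h \<in> H \<Longrightarrow> inv\<^bsub>G\<^esub> h \<in> H"
    and one: "P \<one>\<^bsub>G\<^esub>" and gen: "\<And>h. h \<in> H \<Longrightarrow> P h"
    and mult: "\<And>g h. g \<in> generate G H \<Longrightarrow> h \<in> generate G H \<Longrightarrow> P g \<Longrightarrow> P h \<Longrightarrow> P (g \<otimes>\<^bsub>G\<^esub> h)"
  shows "P g"
  using assms(1)
proof (induction rule: generate.induct)
  case (inv h)
  then show ?case using gen assms(2) by blast
qed (use one gen mult in blast)+

lemma Grp_induct [consumes 1, case_names one fin swap01 swap12 mult]:
  assumes "g \<in> Grp"
    and "P \<one>\<^bsub>Aut3\<^esub>" and "\<And>h. h \<in> finitary letters \<Longrightarrow> P h"
    and "P (directed swap01)" and "P (directed swap12)"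
    and "\<And>g h. g \<in> Grp \<Longrightarrow> h \<in> Grp \<Longrightarrow> P g \<Longrightarrow> P h \<Longrightarrow> P (g \<otimes>\<^bsub>Aut3\<^esub> h)"
  shows "P g"
  using assms(1) unfolding Grp_def
proof (rule generate_induct_inv_closed)
  fix h assume "h \<in> gens"
  then show "P h" using assms(3-5) unfolding gens_def by blast
qed (use assms(2,6) gens_inv in \<open>simp_all add: Grp_def\<close>)

section \<open>The group is a branch group\<close>

lemma sect_directed_mem:
  assumes x: "x permutes letters" and v: "v \<in> lists letters"
  shows "sect letters v (directed x) \<in> finitary letters \<union> {directed x}"
proof (cases "v = replicate (length v) 0")
  case True
  have "sect letters v (directed x) = directed x"
  proof (rule aut_eq_locI[OF sect_in[OF directed_in[OF x] v] directed_in[OF x]])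
    fix u assume u: "u \<in> lists letters"
    have "off_spine (v @ u) \<longleftrightarrow> off_spine u" using True off_spine_zeros_append by metis
    then show "loc letters (sect letters v (directed x)) u = loc letters (directed x) u"
      using loc_sect[OF directed_in[OF x] v u] loc_directed[OF x u] loc_directed[OF x, of "v @ u"] u v
      by simp
  qed
  then show ?thesis by simp
next
  case False
  have "loc letters (sect letters v (directed x)) u = id" if u: "u \<in> lists letters" "1 \<le> length u" for u
  proof -
    have "\<not> off_spine (v @ u)"
    proof
      assume "off_spine (v @ u)"
      then obtain k where k: "v @ u = replicate k 0 @ [1]" by (auto simp: off_spine_def)
      have "length v + length u = k + 1" using arg_cong[OF k, of length] by simp
      with u(2) have "length v \<le> k" by simp
      then have "take (length v) (v @ u) = replicate (length v) 0" unfolding k by simp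
      then show False using False by simp
    qed
    then show ?thesis
      using loc_sect[OF directed_in[OF x] v u(1)] loc_directed[OF x, of "v @ u"] u(1) v by simp
  qed
  then show ?thesis using sect_in[OF directed_in[OF x] v] unfolding finitary_def by blast
qed

lemma finitary_subset_Grp: "finitary letters \<subseteq> Grp"
  using gens_subset_Grp by (auto simp: gens_def)

lemma directed_mem_Grp: "directed swap01 \<in> Grp" "directed swap12 \<in> Grp"
  using gens_subset_Grp by (auto simp: gens_def)

lemma sect_mem_Grp:
  assumes "g \<in> Grp" "v \<in> lists letters"
  shows "sect letters v g \<in> Grp"
  using assms
proof (induction arbitrary: v rule: Grp_induct)
  case one
  have "sect letters v \<one>\<^bsub>Aut3\<^esub> = \<one>\<^bsub>Aut3\<^esub>"
    using one loc_one[of _ letters]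
    by (intro aut_eq_locI[of _ letters]) (simp_all add: sect_in one_in loc_sect)
  then show ?case using subgroup.one_closed[OF subgroup_Grp] by simp
next
  case (fin h)
  then show ?case using finitary_sect finitary_subset_Grp by blast
next
  case swap01
  show ?case
    using sect_directed_mem[OF swap01_permutes swap01] finitary_subset_Grp directed_mem_Grp by auto
next
  case swap12
  show ?case
    using sect_directed_mem[OF swap12_permutes swap12] finitary_subset_Grp directed_mem_Grp by auto
next
  case (mult g h)
  have T: "g \<in> tree_auts letters" "h \<in> tree_auts letters"
    using Grp_subset[OF mult.hyps(1)] Grp_subset[OF mult.hyps(2)] .
  show ?case
    unfolding sect_mult[OF T mult.prems]
    by (rule subgroup.m_closed[OF subgroup_Grp mult.IH(1)[OF aut_closed[OF T(2) mult.prems]]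
          mult.IH(2)[OF mult.prems]])
qed

lemma graft_mem_Grp:
  assumes "g \<in> Grp" "v \<in> lists letters"
  shows "graft letters v g \<in> Grp"
  using assms
proof (induction arbitrary: v rule: Grp_induct)
  case one
  then show ?case using subgroup.one_closed[OF subgroup_Grp] by (simp add: graft_one)
next
  case (fin h)
  then show ?case using finitary_graft finitary_subset_Grp by blast
next
  case swap01
  then show ?case using graft_directed_mem_iff[OF subgroup_Grp finitary_subset_Grp swap01_permutes]
      directed_mem_Grp by simp
next
  case swap12
  then show ?case using graft_directed_mem_iff[OF subgroup_Grp finitary_subset_Grp swap12_permutes]
      directed_mem_Grp by simp
next
  case (mult g h)
  have T: "g \<in> tree_auts letters" "h \<in> tree_auts letters"
    using Grp_subset[OF mult.hyps(1)] Grp_subset[OF mult.hyps(2)] .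
  show ?case
    unfolding graft_mult[OF T mult.prems]
    by (rule subgroup.m_closed[OF subgroup_Grp mult.IH(1)[OF mult.prems] mult.IH(2)[OF mult.prems]])
qed

lemma group_subgrp_Grp: "group (subgrp letters Grp)"
  by (rule group_subgrp[OF subgroup_Grp])

text \<open>Any function with finitely many values whose fibres lie in single cosets bounds the index. It
  serves for the action on a level and for membership in a subgroup of index two.\<close>

lemma finite_index_by_invariant:
  assumes G: "subgroup G (AutTree X)" and H: "subgroup H (AutTree X)" and fin: "finite (f ` G)"
    and inv: "\<And>g h. g \<in> G \<Longrightarrow> h \<in> G \<Longrightarrow> f g = f h \<Longrightarrow> g \<otimes>\<^bsub>AutTree X\<^esub> inv\<^bsub>AutTree X\<^esub> h \<in> H"
  shows "finite_index H (subgrp X G)"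
proof -
  interpret group "AutTree X" by (rule group_AutTree)
  let ?c = "\<lambda>g. H #>\<^bsub>AutTree X\<^esub> g"
  have GT: "g \<in> carrier (AutTree X)" if "g \<in> G" for g using subgroup.subset[OF G] that by blast
  have eq: "?c g = ?c h" if gh: "g \<in> G" "h \<in> G" "f g = f h" for g h
  proof -
    have "g = (g \<otimes>\<^bsub>AutTree X\<^esub> inv\<^bsub>AutTree X\<^esub> h) \<otimes>\<^bsub>AutTree X\<^esub> h"
      using GT[OF gh(1)] GT[OF gh(2)] inv_closed[OF GT[OF gh(2)]] by (simp add: m_assoc l_inv del: carrier_AutTree)
    then have "g \<in> ?c h" using inv[OF gh] unfolding r_coset_def by blast
    then show ?thesis using repr_independence[OF _ GT[OF gh(2)] H] by blast
  qed
  have "?c ` G \<subseteq> (\<lambda>t. ?c (SOME h. h \<in> G \<and> f h = t)) ` (f ` G)"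
  proof
    fix C assume "C \<in> ?c ` G"
    then obtain g where g: "g \<in> G" "C = ?c g" by blast
    have "(SOME h. h \<in> G \<and> f h = f g) \<in> G \<and> f (SOME h. h \<in> G \<and> f h = f g) = f g"
      by (rule someI[of _ g]) (simp add: g)
    then have "C = ?c (SOME h. h \<in> G \<and> f h = f g)" using eq[OF g(1)] g(2) by simp
    then show "C \<in> (\<lambda>t. ?c (SOME h. h \<in> G \<and> f h = t)) ` (f ` G)" using g(1) by blast
  qed
  then have "finite (?c ` G)" using fin finite_surj by blast
  moreover have "rcosets\<^bsub>subgrp X G\<^esub> H = ?c ` G"
    by (auto simp: RCOSETS_def subgrp_def r_coset_def)
  ultimately show ?thesis by (simp add: finite_index_def)
qed

lemma finite_level:
  assumes "finite X"
  shows "finite (level X n)"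
proof -
  have "level X n = {xs. set xs \<subseteq> X \<and> length xs = n}" by (auto simp: level_def in_lists_conv_set)
  then show ?thesis using finite_lists_length_eq[OF assms] by simp
qed

lemma St_loc:
  assumes g: "g \<in> tree_auts letters" and fixed: "\<forall>u\<in>level letters n. g u = u"
    and w: "w \<in> lists letters" "length w < n"
  shows "loc letters g w = id"
proof
  fix x
  show "loc letters g w x = id x"
  proof (cases "x \<in> letters")
    case True
    \<comment> \<open>Padding brings the child \<open>w @ [x]\<close> down to level \<open>n\<close>, where everything is fixed.\<close>
    let ?z = "replicate (n - Suc (length w)) (0::nat)"
    have wx: "w @ [x] \<in> lists letters" using w True by simp
    have "(w @ [x]) @ ?z \<in> level letters n" using w True by (simp add: level_def)
    then have "g ((w @ [x]) @ ?z) = (w @ [x]) @ ?z" using fixed by blast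
    then have "g (w @ [x]) @ sect letters (w @ [x]) g ?z = (w @ [x]) @ ?z"
      using sect_apply[OF g wx zeros_in_lists] by simp
    then have "g (w @ [x]) = w @ [x]"
      using aut_length[OF g wx] by (metis append_eq_append_conv)
    then show ?thesis using True by (simp add: loc_def)
  qed (simp add: loc_def)
qed

text \<open>An automorphism that fixes level \<open>n\<close> has a portrait that is trivial above that level, hence is the
  product of the copies of its sections at level \<open>n\<close>. Adding the vertices of the level one at a time
  makes the product an induction over finite sets.\<close>

lemma St_subset_Rist: "St letters Grp n \<subseteq> Rist letters Grp n"
proof
  fix g assume "g \<in> St letters Grp n"
  then have gG: "g \<in> Grp" and fixed: "\<forall>u\<in>level letters n. g u = u" by (auto simp: St_def)
  have g: "g \<in> tree_auts letters" using gG by (rule Grp_subset)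
  let ?sub = "\<lambda>F. \<Union>v\<in>F. subtree letters v"
  have rist: "graft letters v (sect letters v g) \<in> rist letters Grp v" if v: "v \<in> lists letters" for v
    using graft_mem_Grp[OF sect_mem_Grp[OF gG v] v] graft_not_below[OF sect_in[OF g v]]
    by (auto simp: rist_def in_subtree)
  have "mask letters (?sub F) g \<in> Rist letters Grp n" if "finite F" "F \<subseteq> level letters n" for F
    using that
  proof (induction F)
    case empty
    have "mask letters {} g = \<one>\<^bsub>Aut3\<^esub>"
      by (rule aut_eq_locI[OF mask_in[OF g] one_in]) (simp add: loc_mask[OF g] loc_one)
    moreover have "\<one>\<^bsub>subgrp letters Grp\<^esub> \<in> Rist letters Grp n" unfolding Rist_def by (rule generate.one)
    ultimately show ?case by (simp add: subgrp_def)
  next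
    case (insert v F)
    have v: "v \<in> lists letters" "length v = n" using insert.prems by (auto simp: level_def)
    have lenF: "length u = n" if "u \<in> F" for u using insert.prems that by (auto simp: level_def)
    have disj: "?sub F \<inter> subtree letters v = {}"
    proof -
      have False if "u \<in> F" "u @ a = v @ b" for u a b
        using append_eq_append_conv[of u v a b] that lenF[OF that(1)] v(2) insert.hyps(2) by auto
      then show ?thesis unfolding subtree_def by blast
    qed
    have "mask letters (?sub F) g v = v"
    proof (rule aut_fixI[OF mask_in[OF g] v(1)])
      fix u s assume us: "v = u @ s" "s \<noteq> []"
      then have u: "u \<in> lists letters" "length u < n" using v by auto
      have "u \<notin> ?sub F" using u(2) lenF by (auto simp: subtree_def)
      then show "loc letters (mask letters (?sub F) g) u = id" using loc_mask[OF g u(1)] by simp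
    qed
    then have eq: "mask letters (?sub F \<union> subtree letters v) g
        = graft letters v (sect letters v g) \<otimes>\<^bsub>subgrp letters Grp\<^esub> mask letters (?sub F) g"
      using mask_Un_subtree[OF g v(1) disj] by (simp add: subgrp_def)
    have "graft letters v (sect letters v g) \<in> Rist letters Grp n"
      unfolding Rist_def using rist[OF v(1)] insert.prems by (intro generate.incl) blast
    moreover have "mask letters (?sub F) g \<in> Rist letters Grp n" using insert by simp
    ultimately have "mask letters (?sub F \<union> subtree letters v) g \<in> Rist letters Grp n"
      unfolding eq unfolding Rist_def by (rule generate.eng)
    then show ?case by (simp add: Un_commute)
  qed
  then have "mask letters (?sub (level letters n)) g \<in> Rist letters Grp n"
    using finite_level[OF finite_letters] by blast
  moreover have "mask letters (?sub (level letters n)) g = g"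
  proof (rule aut_eq_locI[OF mask_in[OF g] g])
    fix w assume w: "w \<in> lists letters"
    show "loc letters (mask letters (?sub (level letters n)) g) w = loc letters g w"
    proof (cases "length w < n")
      case True
      then show ?thesis using St_loc[OF g fixed w] loc_mask[OF g w] by simp
    next
      case False
      have "take n w \<in> level letters n" using w False
        by (auto simp: level_def in_lists_conv_set dest: in_set_takeD)
      moreover have "w \<in> subtree letters (take n w)" using w False by (simp add: in_subtree)
      ultimately have "w \<in> ?sub (level letters n)" by blast
      then show ?thesis using loc_mask[OF g w] by simp
    qed
  qed
  ultimately show "g \<in> Rist letters Grp n" by simp
qed

lemma subgroup_Rist: "subgroup (Rist letters Grp n) Aut3"
proof -
  have "subgroup (Rist letters Grp n) (subgrp letters Grp)"
    unfolding Rist_def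
    by (rule group.generate_is_subgroup[OF group_subgrp_Grp]) (auto simp: rist_def subgrp_def)
  then show ?thesis using Aut3.incl_subgroup[OF subgroup_Grp] by (simp add: subgrp_def)
qed

lemma branch_Grp: "branch_group letters Grp"
proof -
  have "\<exists>g\<in>Grp. g u = v" if uv: "u \<in> level letters n" "v \<in> level letters n" for n u v
  proof -
    obtain p where p: "p \<in> finitary letters" "\<And>w. w \<in> lists letters \<Longrightarrow> p (u @ w) = v @ w"
      using finitary_transport[OF uv] by blast
    have "p u = v" using p(2)[of "[]"] by simp
    then show ?thesis using p(1) finitary_subset_Grp by blast
  qed
  then have "spherically_transitive letters Grp" by (simp add: spherically_transitive_def)
  moreover have "finite_index (Rist letters Grp n) (subgrp letters Grp)" for n
  proof (rule finite_index_by_invariant[OF subgroup_Grp subgroup_Rist])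
    \<comment> \<open>Elements that agree on level \<open>n\<close> differ by an element of its stabiliser.\<close>
    let ?f = "\<lambda>g :: nat list \<Rightarrow> nat list. restrict g (level letters n)"
    have "?f ` Grp \<subseteq> level letters n \<rightarrow>\<^sub>E level letters n"
    proof
      fix F assume "F \<in> ?f ` Grp"
      then obtain g where g: "g \<in> Grp" "F = ?f g" by blast
      have "g u \<in> level letters n" if "u \<in> level letters n" for u
        using that aut_closed[OF Grp_subset[OF g(1)], of u] aut_length[OF Grp_subset[OF g(1)], of u]
        by (simp add: level_def)
      then show "F \<in> level letters n \<rightarrow>\<^sub>E level letters n" using g(2) by auto
    qed
    then show "finite (?f ` Grp)"
      by (rule finite_subset) (intro finite_PiE finite_level finite_letters)
  next
    fix g h assume g: "g \<in> Grp" and h: "h \<in> Grp"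
      and eq: "restrict g (level letters n) = restrict h (level letters n)"
    have gT: "g \<in> tree_auts letters" and hT: "h \<in> tree_auts letters"
      using g h by (auto intro: Grp_subset)
    have "(g \<otimes>\<^bsub>Aut3\<^esub> inv\<^bsub>Aut3\<^esub> h) u = u" if u: "u \<in> level letters n" for u
    proof -
      have uL: "u \<in> lists letters" using u by (simp add: level_def)
      obtain t where t: "t \<in> lists letters" "h t = u" using aut_surj[OF hT uL] by blast
      then have tl: "t \<in> level letters n" using aut_length[OF hT t(1)] u by (simp add: level_def)
      have "(inv\<^bsub>Aut3\<^esub> h) u = t" using inv_apply[OF hT t(1)] t(2) by simp
      moreover have "g t = h t" using fun_cong[OF eq, of t] tl by simp
      ultimately show ?thesis using t(2) mult_apply[OF gT inv_in[OF hT] uL] by simp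
    qed
    moreover have "g \<otimes>\<^bsub>Aut3\<^esub> inv\<^bsub>Aut3\<^esub> h \<in> Grp"
      using g h subgroup.m_closed[OF subgroup_Grp] subgroup.m_inv_closed[OF subgroup_Grp] by simp
    ultimately have "g \<otimes>\<^bsub>Aut3\<^esub> inv\<^bsub>Aut3\<^esub> h \<in> St letters Grp n" by (simp add: St_def)
    then show "g \<otimes>\<^bsub>Aut3\<^esub> inv\<^bsub>Aut3\<^esub> h \<in> Rist letters Grp n" using St_subset_Rist by blast
  qed
  ultimately show ?thesis
    unfolding branch_group_def using finite_letters subgroup_Grp by (auto simp: letters_def)
qed

section \<open>Failure of the congruence subgroup property\<close>

definition level_sign :: "nat \<Rightarrow> (nat list \<Rightarrow> nat list) \<Rightarrow> int" where
  "level_sign m g = (\<Prod>v\<in>level letters m. sign (loc letters g v))"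

text \<open>For each fixed level the sign is trivial on a congruence subgroup; only the eventual value escapes
  this, since a copy of a directed automorphism at depth \<open>n\<close> is visible on all levels below \<open>n\<close> and
  invisible above.\<close>

definition sign_kernel :: "(nat list \<Rightarrow> nat list) set" where
  "sign_kernel = {g \<in> tree_auts letters. \<exists>n. \<forall>m\<ge>n. level_sign m g = 1}"

lemma level_sign_mult:
  assumes g: "g \<in> tree_auts letters" and h: "h \<in> tree_auts letters"
  shows "level_sign m (g \<otimes>\<^bsub>Aut3\<^esub> h) = level_sign m g * level_sign m h"
proof -
  let ?L = "level letters m"
  have L: "v \<in> lists letters" if "v \<in> ?L" for v using that by (simp add: level_def)
  have perm: "permutation (loc letters f v)" if "f \<in> tree_auts letters" "v \<in> lists letters" for f v
    using permutes_imp_permutation[OF finite_letters loc_permutes[OF that]] .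
  have "bij_betw h ?L ?L"
  proof (rule bij_betwI')
    show "h u = h v \<longleftrightarrow> u = v" if "u \<in> ?L" "v \<in> ?L" for u v
      using aut_inj[OF h L[OF that(1)] L[OF that(2)]] .
    show "h u \<in> ?L" if "u \<in> ?L" for u
      using aut_closed[OF h L[OF that]] aut_length[OF h L[OF that]] that by (simp add: level_def)
    show "\<exists>u\<in>?L. v = h u" if v: "v \<in> ?L" for v
    proof -
      obtain u where u: "u \<in> lists letters" "h u = v" using aut_surj[OF h L[OF v]] by blast
      then have "u \<in> ?L" using aut_length[OF h u(1)] v by (simp add: level_def)
      then show ?thesis using u(2) by blast
    qed
  qed
  then have reindex: "(\<Prod>v\<in>?L. sign (loc letters g (h v))) = level_sign m g"
    unfolding level_sign_def by (rule prod.reindex_bij_betw)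
  have "sign (loc letters (g \<otimes>\<^bsub>Aut3\<^esub> h) v) = sign (loc letters g (h v)) * sign (loc letters h v)"
    if v: "v \<in> ?L" for v
    using loc_mult[OF g h L[OF v]] sign_compose[OF perm[OF g aut_closed[OF h L[OF v]]] perm[OF h L[OF v]]]
    by simp
  then have "level_sign m (g \<otimes>\<^bsub>Aut3\<^esub> h)
      = (\<Prod>v\<in>?L. sign (loc letters g (h v)) * sign (loc letters h v))"
    unfolding level_sign_def by (rule prod.cong[OF refl])
  then show ?thesis using reindex by (simp add: prod.distrib level_sign_def)
qed

lemma level_sign_one: "level_sign m \<one>\<^bsub>Aut3\<^esub> = 1"
  unfolding level_sign_def by (rule prod.neutral) (simp add: loc_one level_def)

lemma level_sign_inv:
  assumes "g \<in> tree_auts letters"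
  shows "level_sign m g * level_sign m (inv\<^bsub>Aut3\<^esub> g) = 1"
  using level_sign_mult[OF assms inv_in[OF assms]] Aut3.r_inv[of g] assms level_sign_one by simp

lemma normal_sign_kernel: "sign_kernel \<lhd> Aut3"
  unfolding Aut3.normal_inv_iff
proof (intro conjI ballI)
  have T: "g \<in> tree_auts letters" if "g \<in> sign_kernel" for g using that by (simp add: sign_kernel_def)
  show "subgroup sign_kernel Aut3"
  proof (rule Aut3.subgroupI)
    show "sign_kernel \<subseteq> carrier Aut3" using T by auto
    show "sign_kernel \<noteq> {}" using one_in level_sign_one by (auto simp: sign_kernel_def)
  next
    fix g assume g: "g \<in> sign_kernel"
    then obtain n where "\<And>m. n \<le> m \<Longrightarrow> level_sign m g = 1" by (auto simp: sign_kernel_def)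
    then have "level_sign m (inv\<^bsub>Aut3\<^esub> g) = 1" if "n \<le> m" for m
      using level_sign_inv[OF T[OF g], of m] that by simp
    then show "inv\<^bsub>Aut3\<^esub> g \<in> sign_kernel" using inv_in[OF T[OF g]] by (auto simp: sign_kernel_def)
  next
    fix g h assume g: "g \<in> sign_kernel" and h: "h \<in> sign_kernel"
    obtain n where n: "\<And>m. n \<le> m \<Longrightarrow> level_sign m g = 1" using g by (auto simp: sign_kernel_def)
    obtain k where k: "\<And>m. k \<le> m \<Longrightarrow> level_sign m h = 1" using h by (auto simp: sign_kernel_def)
    have "\<forall>m\<ge>max n k. level_sign m (g \<otimes>\<^bsub>Aut3\<^esub> h) = 1"
      using n k level_sign_mult[OF T[OF g] T[OF h]] by simp
    then show "g \<otimes>\<^bsub>Aut3\<^esub> h \<in> sign_kernel"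
      using mult_in[OF T[OF g] T[OF h]] unfolding sign_kernel_def by blast
  qed
next
  fix x h assume x: "x \<in> carrier Aut3" and h: "h \<in> sign_kernel"
  then have xT: "x \<in> tree_auts letters" and hT: "h \<in> tree_auts letters" by (simp_all add: sign_kernel_def)
  obtain n where n: "\<And>m. n \<le> m \<Longrightarrow> level_sign m h = 1" using h by (auto simp: sign_kernel_def)
  have "\<forall>m\<ge>n. level_sign m (x \<otimes>\<^bsub>Aut3\<^esub> h \<otimes>\<^bsub>Aut3\<^esub> inv\<^bsub>Aut3\<^esub> x) = 1"
    using n level_sign_inv[OF xT]
      level_sign_mult[OF xT hT] level_sign_mult[OF mult_in[OF xT hT] inv_in[OF xT]] by simp
  then show "x \<otimes>\<^bsub>Aut3\<^esub> h \<otimes>\<^bsub>Aut3\<^esub> inv\<^bsub>Aut3\<^esub> x \<in> sign_kernel"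
    using mult_in[OF mult_in[OF xT hT] inv_in[OF xT]] unfolding sign_kernel_def by blast
qed

lemma level_sign_graft_directed:
  assumes x: "x permutes letters" and m: "n < m"
  shows "level_sign m (graft letters (replicate n 0) (directed x)) = sign x"
proof -
  let ?v = "replicate (m - 1) 0 @ [1 :: nat]"
  have vL: "?v \<in> level letters m" using m by (simp add: level_def letters_def in_lists_conv_set)
  have "sign (loc letters (graft letters (replicate n 0) (directed x)) v) = (if v = ?v then sign x else 1)"
    if v: "v \<in> level letters m" for v
  proof -
    have "off_spine v \<longleftrightarrow> v = ?v" using v by (auto simp: off_spine_def level_def)
    then show ?thesis using loc_graft_directed[OF x, of v n] v m by (simp add: level_def)
  qed
  then have "level_sign m (graft letters (replicate n 0) (directed x))
      = (\<Prod>v\<in>level letters m. if v = ?v then sign x else 1)"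
    unfolding level_sign_def by (rule prod.cong[OF refl])
  also have "\<dots> = sign x" using vL finite_level[OF finite_letters] by (simp add: prod.delta)
  finally show ?thesis .
qed

text \<open>A directed automorphism is its own copy at the root, written as the word of no zeros to make
  \<open>level_sign_graft_directed\<close> cover it.\<close>

lemma graft_zeros_0: "h \<in> tree_auts letters \<Longrightarrow> graft letters (replicate 0 0) h = h"
  by (rule aut_eq_locI[of _ letters]) (simp_all add: graft_in loc_graft)

lemma sign_swaps: "sign swap01 = -1" "sign swap12 = -1"
  by (simp_all add: swap01_def swap12_def sign_swap_id)

lemma level_sign_eventually_const:
  assumes "g \<in> Grp"
  shows "\<exists>s\<in>{1, -1}. \<exists>n. \<forall>m\<ge>n. level_sign m g = s"
  using assms
proof (induction rule: Grp_induct)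
  case one
  show ?case by (simp add: level_sign_one)
next
  case (fin h)
  then obtain n where n: "\<forall>v\<in>lists letters. n \<le> length v \<longrightarrow> loc letters h v = id"
    by (auto simp: finitary_def)
  have "level_sign m h = 1" if "n \<le> m" for m
    unfolding level_sign_def using n that by (intro prod.neutral) (simp add: level_def)
  then show ?case by blast
next
  case swap01
  have "level_sign m (directed swap01) = -1" if "1 \<le> m" for m
    using level_sign_graft_directed[OF swap01_permutes, of 0 m] that sign_swaps
      graft_zeros_0[OF directed_in[OF swap01_permutes]] by simp
  then show ?case by blast
next
  case swap12
  have "level_sign m (directed swap12) = -1" if "1 \<le> m" for m
    using level_sign_graft_directed[OF swap12_permutes, of 0 m] that sign_swaps
      graft_zeros_0[OF directed_in[OF swap12_permutes]] by simp
  then show ?case by blast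
next
  case (mult g h)
  obtain s n where s: "s \<in> {1, -1}" "\<And>m. n \<le> m \<Longrightarrow> level_sign m g = s" using mult.IH(1) by blast
  obtain t k where t: "t \<in> {1, -1}" "\<And>m. k \<le> m \<Longrightarrow> level_sign m h = t" using mult.IH(2) by blast
  have "\<forall>m\<ge>max n k. level_sign m (g \<otimes>\<^bsub>Aut3\<^esub> h) = s * t"
    using s t level_sign_mult[OF Grp_subset[OF mult.hyps(1)] Grp_subset[OF mult.hyps(2)]] by simp
  moreover have "s * t \<in> {1, -1}" using s(1) t(1) by auto
  ultimately show ?case by blast
qed

lemma not_CSP_Grp: "\<not> congruence_subgroup_property letters Grp"
proof
  assume csp: "congruence_subgroup_property letters Grp"
  let ?K = "sign_kernel \<inter> Grp"
  have normal: "?K \<lhd> subgrp letters Grp"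
    unfolding subgrp_def by (rule Aut3.normal_Int_subgroup[OF subgroup_Grp normal_sign_kernel])
  have "subgroup ?K Aut3"
    using Aut3.subgroups_Inter_pair[OF normal_imp_subgroup[OF normal_sign_kernel] subgroup_Grp] .
  then have "finite_index ?K (subgrp letters Grp)"
  proof (rule finite_index_by_invariant[OF subgroup_Grp])
    show "finite ((\<lambda>g. g \<in> sign_kernel) ` Grp)" by (rule finite_subset[of _ UNIV]) simp_all
    fix g h assume g: "g \<in> Grp" and h: "h \<in> Grp" and eq: "(g \<in> sign_kernel) = (h \<in> sign_kernel)"
    have gT: "g \<in> tree_auts letters" and hT: "h \<in> tree_auts letters"
      using Grp_subset[OF g] Grp_subset[OF h] .
    obtain s n where s: "s \<in> {1, -1}" "\<And>m. n \<le> m \<Longrightarrow> level_sign m g = s"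
      using level_sign_eventually_const[OF g] by blast
    obtain t k where t: "t \<in> {1, -1}" "\<And>m. k \<le> m \<Longrightarrow> level_sign m h = t"
      using level_sign_eventually_const[OF h] by blast
    have "g \<in> sign_kernel \<longleftrightarrow> s = 1"
    proof
      assume "g \<in> sign_kernel"
      then obtain j where "\<forall>m\<ge>j. level_sign m g = 1" by (auto simp: sign_kernel_def)
      then show "s = 1" using s(2)[of "max j n"] by simp
    qed (use s gT in \<open>auto simp: sign_kernel_def\<close>)
    moreover have "h \<in> sign_kernel \<longleftrightarrow> t = 1"
    proof
      assume "h \<in> sign_kernel"
      then obtain j where "\<forall>m\<ge>j. level_sign m h = 1" by (auto simp: sign_kernel_def)
      then show "t = 1" using t(2)[of "max j k"] by simp
    qed (use t hT in \<open>auto simp: sign_kernel_def\<close>)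
    ultimately have st: "s = t" using eq s(1) t(1) by auto
    have "level_sign m (g \<otimes>\<^bsub>Aut3\<^esub> inv\<^bsub>Aut3\<^esub> h) = 1" if m: "max n k \<le> m" for m
      using level_sign_mult[OF gT inv_in[OF hT], of m] level_sign_inv[OF hT, of m]
        s(2)[of m] t(2)[of m] st m by simp
    then have "g \<otimes>\<^bsub>Aut3\<^esub> inv\<^bsub>Aut3\<^esub> h \<in> sign_kernel"
      using mult_in[OF gT inv_in[OF hT]] unfolding sign_kernel_def by blast
    moreover have "g \<otimes>\<^bsub>Aut3\<^esub> inv\<^bsub>Aut3\<^esub> h \<in> Grp"
      using g h subgroup.m_closed[OF subgroup_Grp] subgroup.m_inv_closed[OF subgroup_Grp] by simp
    ultimately show "g \<otimes>\<^bsub>Aut3\<^esub> inv\<^bsub>Aut3\<^esub> h \<in> ?K" by blast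
  qed
  then obtain n where n: "St letters Grp n \<subseteq> ?K"
    using csp normal unfolding congruence_subgroup_property_def by blast
  \<comment> \<open>This copy fixes level \<open>n\<close> but has sign \<open>-1\<close> on every deeper level.\<close>
  let ?z = "replicate n (0::nat)"
  let ?g = "graft letters ?z (directed swap01)"
  have d: "directed swap01 \<in> tree_auts letters" by (rule directed_in[OF swap01_permutes])
  have "?g u = u" if u: "u \<in> level letters n" for u
  proof (rule graft_off[OF d])
    show "u \<in> lists letters" using u by (simp add: level_def)
    have "length u = n" using u by (simp add: level_def)
    moreover have "length u = n + length s" if "u = ?z @ s" for s using arg_cong[OF that, of length] by simp
    ultimately show "\<nexists>s. s \<noteq> [] \<and> u = ?z @ s" by fastforce
  qed
  moreover have "?g \<in> Grp" using graft_mem_Grp[OF directed_mem_Grp(1) zeros_in_lists] .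
  ultimately have "?g \<in> St letters Grp n" by (simp add: St_def)
  then have "?g \<in> sign_kernel" using n by blast
  then obtain k where "\<forall>m\<ge>k. level_sign m ?g = 1" by (auto simp: sign_kernel_def)
  then have "level_sign (max k (Suc n)) ?g = 1" by simp
  then show False
    using level_sign_graft_directed[OF swap01_permutes, of n "max k (Suc n)"] sign_swaps by simp
qed

section \<open>A maximal subgroup of infinite index\<close>

text \<open>At deep vertices finitary automorphisms have trivial letter permutations and \<open>directed swap01\<close>
  has only \<open>id\<close> and \<open>swap01\<close>. These two form a group, so the same holds for all products, whereas \<open>directed swap12\<close>
  has \<open>swap12\<close> at arbitrarily deep vertices.\<close>

lemma directed_swap12_not_generated:
  "directed swap12 \<notin> generate Aut3 (finitary letters \<union> {directed swap01})"
proof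
  let ?H = "finitary letters \<union> {directed swap01}"
  let ?P = "\<lambda>g. g \<in> tree_auts letters \<and>
    (\<exists>n. \<forall>v\<in>lists letters. n \<le> length v \<longrightarrow> loc letters g v \<in> {id, swap01})"
  assume "directed swap12 \<in> generate Aut3 ?H"
  then have "?P (directed swap12)"
  proof (rule generate_induct_inv_closed)
    show "inv\<^bsub>Aut3\<^esub> h \<in> ?H" if "h \<in> ?H" for h
      using that finitary_inv by (auto simp: inv_directed_swap)
    show "?P \<one>\<^bsub>Aut3\<^esub>" by (simp add: one_in loc_one)
    show "?P h" if h: "h \<in> ?H" for h
    proof -
      have "?P (directed swap01)"
        by (simp add: directed_in swap01_permutes loc_directed)
      moreover have "?P h" if "h \<in> finitary letters" using that unfolding finitary_def by blast
      ultimately show ?thesis using h by blast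
    qed
    fix g h assume g: "?P g" and h: "?P h"
    then obtain n k where
      n: "\<And>v. v \<in> lists letters \<Longrightarrow> n \<le> length v \<Longrightarrow> loc letters g v \<in> {id, swap01}" and
      k: "\<And>v. v \<in> lists letters \<Longrightarrow> k \<le> length v \<Longrightarrow> loc letters h v \<in> {id, swap01}" by blast
    have gT: "g \<in> tree_auts letters" and hT: "h \<in> tree_auts letters" using g h by blast+
    have "swap01 \<circ> swap01 = id" by (simp add: swap01_def)
    then have "loc letters (g \<otimes>\<^bsub>Aut3\<^esub> h) v \<in> {id, swap01}"
      if v: "v \<in> lists letters" "max n k \<le> length v" for v
      using loc_mult[OF gT hT v(1)] n[OF aut_closed[OF hT v(1)]] k[OF v(1)] v(2) aut_length[OF hT v(1)]
      by auto
    then show "?P (g \<otimes>\<^bsub>Aut3\<^esub> h)" using mult_in[OF gT hT] by blast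
  qed
  then obtain n where n: "\<And>v. v \<in> lists letters \<Longrightarrow> n \<le> length v \<Longrightarrow> loc letters (directed swap12) v \<in> {id, swap01}"
    by blast
  let ?v = "replicate n 0 @ [1 :: nat]"
  have off: "off_spine ?v" by (auto simp: off_spine_def)
  then have "swap12 \<in> {id, swap01}"
    using n[OF off_spine_in_lists[OF off]] loc_directed[OF swap12_permutes off_spine_in_lists[OF off]] by simp
  moreover have "swap12 2 = 1" "id 2 = (2::nat)" "swap01 2 = 2"
    by (simp_all add: swap01_def swap12_def Transposition.transpose_def)
  ultimately show False by auto
qed

text \<open>The product of the two transpositions is a 3-cycle, so its square is its inverse.\<close>

lemma directed_swap_relation:
  "directed swap01 \<otimes>\<^bsub>Aut3\<^esub> (directed swap12 \<otimes>\<^bsub>Aut3\<^esub> (directed swap01 \<otimes>\<^bsub>Aut3\<^esub> directed swap12))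
    = directed swap12 \<otimes>\<^bsub>Aut3\<^esub> directed swap01"
proof -
  have "swap01 \<circ> (swap12 \<circ> (swap01 \<circ> swap12)) = swap12 \<circ> swap01"
    by (rule ext) (simp add: swap01_def swap12_def Transposition.transpose_def)
  then show ?thesis
    by (simp add: directed_mult swap01_permutes swap12_permutes permutes_compose)
qed

text \<open>Finite index puts a product of two copies of \<open>directed swap12\<close> at different vertices into the
  subgroup. Copies of \<open>directed swap01\<close> are there anyway; they commute with the second copy and
  isolate the first.\<close>

lemma directed_swap12_mem_of_finite_index:
  assumes M: "subgroup M Aut3" and MG: "M \<subseteq> Grp" and fin: "finitary letters \<subseteq> M"
    and a: "directed swap01 \<in> M" and index: "finite_index M (subgrp letters Grp)"
  shows "directed swap12 \<in> M"
proof -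
  define w where "w = (\<lambda>i. replicate i (0::nat) @ [1])"
  define A where "A = (\<lambda>i. graft letters (w i) (directed swap01))"
  define B where "B = (\<lambda>i. graft letters (w i) (directed swap12))"
  have w: "w i \<in> lists letters" for i by (simp add: w_def letters_def[symmetric]) (simp add: letters_def)
  have da: "directed swap01 \<in> tree_auts letters" and db: "directed swap12 \<in> tree_auts letters"
    by (simp_all add: directed_in swap01_permutes swap12_permutes)
  have AT: "A i \<in> carrier Aut3" and BT: "B i \<in> carrier Aut3" for i
    by (simp_all add: A_def B_def graft_in da db)
  have AM: "A i \<in> M" for i
    unfolding A_def using graft_directed_mem_iff[OF M fin swap01_permutes w] a by simp
  have BG: "B i \<in> Grp" for i
    unfolding B_def by (rule graft_mem_Grp[OF directed_mem_Grp(2) w])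
  have AA: "A i \<otimes>\<^bsub>Aut3\<^esub> A i = \<one>\<^bsub>Aut3\<^esub>" and BB: "B i \<otimes>\<^bsub>Aut3\<^esub> B i = \<one>\<^bsub>Aut3\<^esub>" for i
    unfolding A_def B_def
    by (simp_all add: graft_mult[OF da da w, symmetric] graft_mult[OF db db w, symmetric]
        directed_swap_square graft_one[OF w])
  have rel: "A i \<otimes>\<^bsub>Aut3\<^esub> (B i \<otimes>\<^bsub>Aut3\<^esub> (A i \<otimes>\<^bsub>Aut3\<^esub> B i)) = B i \<otimes>\<^bsub>Aut3\<^esub> A i" for i
    unfolding A_def B_def
    by (simp add: graft_mult[OF _ _ w, symmetric] da db mult_in directed_swap_relation)
  \<comment> \<open>The vertices \<open>w i\<close> form an antichain, so copies at different ones commute.\<close>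
  have not_below: "take (length (w i)) (w j) \<noteq> w i" if "i \<noteq> j" for i j
  proof
    assume "take (length (w i)) (w j) = w i"
    then obtain u where u: "w j = w i @ u" unfolding take_eq_iff_append by blast
    have off: "off_spine (w i)" "off_spine (w j)" by (auto simp: w_def off_spine_def)
    then have "u = []" using off_spine_below_off_spine[OF off(1), of u] u by metis
    then have "length (w j) = length (w i)" using u by simp
    then show False using that by (simp add: w_def)
  qed
  have "range (\<lambda>i. M #>\<^bsub>subgrp letters Grp\<^esub> B i) \<subseteq> rcosets\<^bsub>subgrp letters Grp\<^esub> M"
    using BG by (auto simp: RCOSETS_def subgrp_def)
  then have "finite (range (\<lambda>i. M #>\<^bsub>subgrp letters Grp\<^esub> B i))"
    using index finite_subset unfolding finite_index_def by blast
  then have "\<not> inj (\<lambda>i. M #>\<^bsub>subgrp letters Grp\<^esub> B i)"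
    using finite_imageD[of _ "UNIV :: nat set"] infinite_UNIV_nat by blast
  then obtain i j where ij: "i \<noteq> j" "M #>\<^bsub>Aut3\<^esub> B i = M #>\<^bsub>Aut3\<^esub> B j"
    unfolding inj_def by (auto simp: r_coset_def subgrp_def)
  have "B i \<in> M #>\<^bsub>Aut3\<^esub> B j"
    using Aut3.repr_independenceD[OF M BT[of i]] ij(2) by simp
  then obtain c where c: "c \<in> M" "B i = c \<otimes>\<^bsub>Aut3\<^esub> B j" by (auto simp: r_coset_def)
  have cT: "c \<in> carrier Aut3" using c(1) subgroup.subset[OF M] by blast
  have "B i \<otimes>\<^bsub>Aut3\<^esub> B j = c"
    using c(2) cT BT[of j] BB[of j] by (simp add: Aut3.m_assoc del: carrier_AutTree)
  then have BijM: "B i \<otimes>\<^bsub>Aut3\<^esub> B j \<in> M" using c(1) by simp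
  have BjA: "B j \<otimes>\<^bsub>Aut3\<^esub> A i = A i \<otimes>\<^bsub>Aut3\<^esub> B j" and BjB: "B j \<otimes>\<^bsub>Aut3\<^esub> B i = B i \<otimes>\<^bsub>Aut3\<^esub> B j"
    unfolding A_def B_def
    using graft_commute[OF db da w w not_below not_below] graft_commute[OF db db w w not_below not_below] ij(1)
    by metis+
  have BjA': "B j \<otimes>\<^bsub>Aut3\<^esub> (A i \<otimes>\<^bsub>Aut3\<^esub> z) = A i \<otimes>\<^bsub>Aut3\<^esub> (B j \<otimes>\<^bsub>Aut3\<^esub> z)"
    if "z \<in> carrier Aut3" for z
    using BjA Aut3.m_assoc[OF BT[of j] AT[of i] that] Aut3.m_assoc[OF AT[of i] BT[of j] that] by simp
  have BjB': "B j \<otimes>\<^bsub>Aut3\<^esub> (B i \<otimes>\<^bsub>Aut3\<^esub> z) = B i \<otimes>\<^bsub>Aut3\<^esub> (B j \<otimes>\<^bsub>Aut3\<^esub> z)"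
    if "z \<in> carrier Aut3" for z
    using BjB Aut3.m_assoc[OF BT[of j] BT[of i] that] Aut3.m_assoc[OF BT[of i] BT[of j] that] by simp
  let ?s = "A i \<otimes>\<^bsub>Aut3\<^esub> (B i \<otimes>\<^bsub>Aut3\<^esub> B j)"
  have "?s \<otimes>\<^bsub>Aut3\<^esub> ?s = A i \<otimes>\<^bsub>Aut3\<^esub> (B i \<otimes>\<^bsub>Aut3\<^esub> (A i \<otimes>\<^bsub>Aut3\<^esub> B i))"
    using AT BT by (simp add: Aut3.m_assoc BjA' BjB' BB del: carrier_AutTree)
  then have "?s \<otimes>\<^bsub>Aut3\<^esub> ?s = B i \<otimes>\<^bsub>Aut3\<^esub> A i" using rel by simp
  moreover have "?s \<in> M" by (rule subgroup.m_closed[OF M AM BijM])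
  ultimately have "B i \<otimes>\<^bsub>Aut3\<^esub> A i \<in> M" using subgroup.m_closed[OF M] by metis
  then have "(B i \<otimes>\<^bsub>Aut3\<^esub> A i) \<otimes>\<^bsub>Aut3\<^esub> A i \<in> M" using AM by (rule subgroup.m_closed[OF M])
  then have "B i \<in> M" using AT BT AA by (simp add: Aut3.m_assoc del: carrier_AutTree)
  then show ?thesis
    unfolding B_def using graft_directed_mem_iff[OF M fin swap12_permutes w] by simp
qed

text \<open>A subgroup that is maximal among those containing the finitary automorphisms and
  \<open>directed swap01\<close> but not \<open>directed swap12\<close> is a maximal subgroup: anything larger contains all
  generators.\<close>

lemma not_MF_Grp: "\<not> in_MF (subgrp letters Grp)"
proof
  assume mf: "in_MF (subgrp letters Grp)"
  let ?H = "finitary letters \<union> {directed swap01}"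
  define F where "F = {M. subgroup M Aut3 \<and> M \<subseteq> Grp \<and> ?H \<subseteq> M \<and> directed swap12 \<notin> M}"
  have HT: "?H \<subseteq> carrier Aut3" using gens_subset by (auto simp: gens_def)
  have "generate Aut3 ?H \<in> F"
    unfolding F_def
  proof (intro CollectI conjI)
    show "subgroup (generate Aut3 ?H) Aut3" by (rule Aut3.generate_is_subgroup[OF HT])
    show "generate Aut3 ?H \<subseteq> Grp"
      by (rule Aut3.generate_subgroup_incl[OF _ subgroup_Grp])
         (use finitary_subset_Grp directed_mem_Grp in blast)
    show "?H \<subseteq> generate Aut3 ?H" by (blast intro: generate.incl)
    show "directed swap12 \<notin> generate Aut3 ?H" by (rule directed_swap12_not_generated)
  qed
  then have "F \<noteq> {}" by blast
  moreover have "\<Union>\<C> \<in> F" if C: "\<C> \<noteq> {}" "subset.chain F \<C>" for \<C>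
  proof -
    have CF: "\<C> \<subseteq> F" and lin: "\<And>M N. M \<in> \<C> \<Longrightarrow> N \<in> \<C> \<Longrightarrow> M \<subseteq> N \<or> N \<subseteq> M"
      using C(2) unfolding subset_chain_def by blast+
    have sub: "subgroup M Aut3" if "M \<in> \<C>" for M using CF that by (auto simp: F_def)
    have "subgroup (\<Union>\<C>) Aut3"
    proof (rule Aut3.subgroupI)
      show "\<Union>\<C> \<subseteq> carrier Aut3" using subgroup.subset[OF sub] by blast
      show "\<Union>\<C> \<noteq> {}" using C(1) subgroup.one_closed[OF sub] by blast
    next
      fix g assume "g \<in> \<Union>\<C>"
      then show "inv\<^bsub>Aut3\<^esub> g \<in> \<Union>\<C>" using subgroup.m_inv_closed[OF sub] by blast
    next
      fix g h assume "g \<in> \<Union>\<C>" "h \<in> \<Union>\<C>"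
      then obtain M where "M \<in> \<C>" "g \<in> M" "h \<in> M" using lin by blast
      then show "g \<otimes>\<^bsub>Aut3\<^esub> h \<in> \<Union>\<C>" using subgroup.m_closed[OF sub] by blast
    qed
    moreover have "\<Union>\<C> \<subseteq> Grp" "directed swap12 \<notin> \<Union>\<C>" using CF by (auto simp: F_def)
    moreover have "?H \<subseteq> \<Union>\<C>" using CF C(1) unfolding F_def by blast
    ultimately show ?thesis unfolding F_def by blast
  qed
  ultimately obtain M where MF: "M \<in> F" and max: "\<And>N. N \<in> F \<Longrightarrow> M \<subseteq> N \<Longrightarrow> N = M"
    using subset_Zorn_nonempty[of F] by metis
  have M: "subgroup M Aut3" "M \<subseteq> Grp" "finitary letters \<subseteq> M" "directed swap01 \<in> M" "directed swap12 \<notin> M"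
    using MF unfolding F_def by blast+
  have "maximal_subgroup M (subgrp letters Grp)"
    unfolding maximal_subgroup_def
  proof (intro conjI allI impI)
    show "subgroup M (subgrp letters Grp)"
      unfolding subgrp_def by (rule Aut3.subgroup_incl[OF M(1) subgroup_Grp M(2)])
    show "M \<noteq> carrier (subgrp letters Grp)" using M(5) directed_mem_Grp(2) by (auto simp: subgrp_def)
    fix N assume "subgroup N (subgrp letters Grp)" and MN: "M \<subseteq> N"
    then have N: "subgroup N Aut3" "N \<subseteq> Grp"
      using Aut3.incl_subgroup[OF subgroup_Grp] subgroup.subset[of N "subgrp letters Grp"]
      by (simp_all add: subgrp_def)
    show "N = M \<or> N = carrier (subgrp letters Grp)"
    proof (cases "directed swap12 \<in> N")
      case True
      then have "gens \<subseteq> N" using MN M(3,4) unfolding gens_def by blast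
      then have "Grp \<subseteq> N" unfolding Grp_def by (rule Aut3.generate_subgroup_incl[OF _ N(1)])
      then show ?thesis using N(2) by (auto simp: subgrp_def)
    next
      case False
      then have "N \<in> F" using N MN M(3,4) unfolding F_def by blast
      then show ?thesis using max MN by blast
    qed
  qed
  then have "finite_index M (subgrp letters Grp)" using mf by (simp add: in_MF_def)
  then have "directed swap12 \<in> M" using directed_swap12_mem_of_finite_index[OF M(1-4)] by blast
  then show False using M(5) by blast
qed

theorem mainTheorem6:
  shows "\<exists>(X :: nat set) G. branch_group X G \<and> \<not> in_MF (subgrp X G) \<and>
           \<not> congruence_subgroup_property X G"
  using branch_Grp not_MF_Grp not_CSP_Grp by blast

end
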